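(* For every $n \geq 1$, the antipode $S$ of $\mathcal{H}^1_{\mathrm{CM}}$ satisfies $$S(\delta_n) = \sum_{\substack{\boldsymbol{n} = (n_1,\ldots,n_s) \in \mathcal{N} \\ n_1 + \cdots + n_s = n}} \frac{n!}{n_1! \cdots n_s!}\, \beta^{n_1,\ldots,n_s}\, \delta_{n_1} \cdots \delta_{n_s},$$ where $\beta^{n_1} = -1$ and, for $(n_1,\ldots,n_{s+1}) \in \mathcal{N}$ with $s \geq 1$, writing $\boldsymbol{n} = (n_1,\ldots,n_s)$, $$\beta^{n_1,\ldots,n_s,n_{s+1}} = \sum_{t=1}^{s} \sum_{\boldsymbol{n}^1 \cdots \boldsymbol{n}^t = \boldsymbol{n}} U^{\|\boldsymbol{n}^1\|,\ldots,\|\boldsymbol{n}^t\|}_{n_{s+1}}\, A(\boldsymbol{n}^1,\ldots,\boldsymbol{n}^t),$$ and where, for $\boldsymbol{m} = (m_1,\ldots,m_t) \in \mathcal{N}$ and $k \geq 1$, $$U^{\boldsymbol{m}}_k = \sum_{i=1}^{l(\boldsymbol{m})} (-1)^{i-1} \sum_{\boldsymbol{m}^1 \cdots \boldsymbol{m}^i = \boldsymbol{m}} B_k(\boldsymbol{m}^1,\ldots,\boldsymbol{m}^i).$$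
   Context: The Connes-Moscovici Hopf algebra $\mathcal{H}_{\mathrm{CM}}$ is, as an algebra, the enveloping algebra of the (real) Lie algebra with linear basis $Y$, $X$, $\delta_n$ ($n \geq 1$) and relations $[Y,X] = X$, $[Y,\delta_n] = n\delta_n$, $[\delta_n,\delta_m] = 0$, $[X,\delta_n] = \delta_{n+1}$ for all $m,n \geq 1$. Its coproduct $\Delta$ is the algebra morphism ($\Delta(h_1h_2) = \Delta(h_1)\Delta(h_2)$) determined by $\Delta(Y) = Y \otimes 1 + 1 \otimes Y$, $\Delta(X) = X \otimes 1 + 1 \otimes X + \delta_1 \otimes Y$, $\Delta(\delta_1) = \delta_1 \otimes 1 + 1 \otimes \delta_1$; the coproducts $\Delta(\delta_n)$ are then determined recursively by $\delta_{n+1} = [X,\delta_n]$. The subalgebra $\mathcal{H}^1_{\mathrm{CM}} \subset \mathcal{H}_{\mathrm{CM}}$ generated by $\{\delta_n : n \geq 1\}$ is a sub-Hopf algebra, graded by $\mathrm{gr}(\delta_{n_1} \cdots \delta_{n_s}) = n_1 + \cdots + n_s$. Notation. $\mathbb{N}^* = \{1,2,\ldots\}$, and $\mathcal{N} = \{\boldsymbol{n} = (n_1,\ldots,n_s) \in (\mathbb{N}^* )^s : s \geq 1\}$ is the set of nonempty finite sequences of positive integers. For $\boldsymbol{n} = (n_1,\ldots,n_s) \in \mathcal{N}$: $\|\boldsymbol{n}\| = n_1 + \cdots + n_s$ and $l(\boldsymbol{n}) = s$. The sum $\sum_{\boldsymbol{n}^1 \cdots \boldsymbol{n}^t = \boldsymbol{n}}$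 (with $t$ fixed) is over all $t$-tuples $(\boldsymbol{n}^1,\ldots,\boldsymbol{n}^t) \in \mathcal{N}^t$ of nonempty sequences whose concatenation is $\boldsymbol{n}$. For $(\boldsymbol{n}^1,\ldots,\boldsymbol{n}^t) \in \mathcal{N}^t$ and $k \geq 1$, $$A(\boldsymbol{n}^1,\ldots,\boldsymbol{n}^t) = \frac{1}{l(\boldsymbol{n}^1)! \cdots l(\boldsymbol{n}^t)!} \prod_{i=1}^t \frac{1}{\|\boldsymbol{n}^i\| + 1},$$ $$B_k(\boldsymbol{n}^1,\ldots,\boldsymbol{n}^t) = \binom{k}{l(\boldsymbol{n}^t)} \prod_{i=1}^{t-1} \binom{\|\boldsymbol{n}^{i+1}\| + \cdots + \|\boldsymbol{n}^t\| + k}{l(\boldsymbol{n}^i)},$$ with the convention $\binom{a}{b} = 0$ if $b > a$. *)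

theory Defs
  imports "HOL-Analysis.Linear_Algebra" "HOL-Analysis.Finite_Function_Topology"
begin

section \<open>Free real vector spaces and monoid algebras\<close>

text \<open>
  \<open>'a \<Rightarrow>\<^sub>0 real\<close> is the real vector space with basis \<open>'a\<close>; if \<open>'a\<close> is a monoid (written additively),
  its multiplication is the one of the monoid algebra.
\<close>

lemma lookup_scaleR [simp]: "poly_mapping.lookup (c *\<^sub>R f) k = c *\<^sub>R poly_mapping.lookup f k"
  unfolding scaleR_poly_mapping_def
  by (subst lookup_Abs_poly_mapping) (auto intro: finite_subset[OF _ finite_lookup[of f]])

lemma keys_scaleR_subset: "Poly_Mapping.keys (c *\<^sub>R f) \<subseteq> Poly_Mapping.keys f"
  by (auto simp: in_keys_iff)

lemma single_scaleR: "Poly_Mapping.single k (c *\<^sub>R x) = c *\<^sub>R Poly_Mapping.single k x"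
  by (rule poly_mapping_eqI) (simp add: lookup_single when_def)

definition lin_ext :: "('a \<Rightarrow> 'b::real_vector) \<Rightarrow> ('a \<Rightarrow>\<^sub>0 real) \<Rightarrow> 'b" where
  "lin_ext \<phi> p = (\<Sum>k\<in>Poly_Mapping.keys p. poly_mapping.lookup p k *\<^sub>R \<phi> k)"

lemma lin_ext_superset:
  assumes "finite A" "Poly_Mapping.keys p \<subseteq> A"
  shows "lin_ext \<phi> p = (\<Sum>k\<in>A. poly_mapping.lookup p k *\<^sub>R \<phi> k)"
  unfolding lin_ext_def using assms
  by (intro sum.mono_neutral_left) (auto simp: in_keys_iff)

lemma linear_lin_ext: "linear (lin_ext \<phi>)"
proof (rule linearI)
  fix p q :: "'a \<Rightarrow>\<^sub>0 real" and c :: real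
  let ?A = "Poly_Mapping.keys p \<union> Poly_Mapping.keys q"
  have "Poly_Mapping.keys (p + q) \<subseteq> ?A" by (rule keys_add)
  then show "lin_ext \<phi> (p + q) = lin_ext \<phi> p + lin_ext \<phi> q"
    by (simp add: lin_ext_superset[of ?A] lookup_add scaleR_add_left sum.distrib)
  show "lin_ext \<phi> (c *\<^sub>R p) = c *\<^sub>R lin_ext \<phi> p"
    using keys_scaleR_subset[of c p]
    by (simp add: lin_ext_superset[of "Poly_Mapping.keys p"] scaleR_sum_right)
qed

lemma lin_ext_single [simp]: "lin_ext \<phi> (Poly_Mapping.single k c) = c *\<^sub>R \<phi> k"
  by (simp add: lin_ext_def)

lemma pm_expand:
  "p = (\<Sum>k\<in>Poly_Mapping.keys p. poly_mapping.lookup p k *\<^sub>R Poly_Mapping.single k (1::real))"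
  by (rule poly_mapping_eqI)
     (simp add: lookup_sum lookup_single when_def in_keys_iff if_distrib[of "\<lambda>x. _ * x"] cong: if_cong)

lemma span_singles: "span (range (\<lambda>k. Poly_Mapping.single k (1::real))) = UNIV"
proof (intro equalityI subset_UNIV subsetI)
  fix p :: "'a \<Rightarrow>\<^sub>0 real"
  show "p \<in> span (range (\<lambda>k. Poly_Mapping.single k (1::real)))"
    by (subst pm_expand) (intro span_sum span_scale span_base rangeI)
qed

lemma linear_eq_on_singles:
  fixes f g :: "('a \<Rightarrow>\<^sub>0 real) \<Rightarrow> 'b::real_vector"
  assumes "linear f" "linear g" "\<And>k. f (Poly_Mapping.single k 1) = g (Poly_Mapping.single k 1)"
  shows "f p = g p"
  by (rule linear_eq_on[OF assms(1,2), of _ "range (\<lambda>k. Poly_Mapping.single k 1)"])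
     (auto simp: span_singles assms(3))

lemma linear_single_eq:
  assumes "linear f"
  shows "f (Poly_Mapping.single k c) = c *\<^sub>R f (Poly_Mapping.single k (1::real))"
  using linear_scale[OF assms, of c "Poly_Mapping.single k 1"] single_scaleR[of k c "1::real"] by simp

lemma scaleR_conv_single_mult:
  "c *\<^sub>R f = Poly_Mapping.single 0 c * (f :: 'a::monoid_add \<Rightarrow>\<^sub>0 real)"
proof -
  have "c *\<^sub>R f = Poly_Mapping.map ((*) c) f"
    by (rule poly_mapping_eqI) (simp add: map.rep_eq when_def)
  then show ?thesis by (simp add: mult_map_scale_conv_mult)
qed

lemma pm_mult_scaleR_left: "(c *\<^sub>R f) * g = c *\<^sub>R (f * (g :: 'a::monoid_add \<Rightarrow>\<^sub>0 real))"
  by (simp add: scaleR_conv_single_mult mult.assoc)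

lemma linear_pm_times_left: "linear (\<lambda>f. f * (g :: 'a::monoid_add \<Rightarrow>\<^sub>0 real))"
  by (rule linearI) (simp_all add: pm_mult_scaleR_left distrib_right)

lemma pm_single0_comm: 
  "(f :: 'a::monoid_add \<Rightarrow>\<^sub>0 real) * Poly_Mapping.single 0 c = Poly_Mapping.single 0 c * f"
proof (rule linear_eq_on_singles[of "\<lambda>f. f * Poly_Mapping.single 0 c" "(*) (Poly_Mapping.single 0 c)"])
  show "linear (\<lambda>f. f * Poly_Mapping.single (0::'a) c)" by (rule linear_pm_times_left)
  show "linear ((*) (Poly_Mapping.single (0::'a) c))"
    unfolding scaleR_conv_single_mult[symmetric] by (rule linear_scale_self)
qed (simp add: mult_single)

lemma pm_mult_scaleR_right: "f * (c *\<^sub>R g) = c *\<^sub>R (f * (g :: 'a::monoid_add \<Rightarrow>\<^sub>0 real))"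
  by (simp only: scaleR_conv_single_mult mult.assoc[symmetric] pm_single0_comm)

lemma linear_pm_times_right: "linear (\<lambda>g. f * (g :: 'a::monoid_add \<Rightarrow>\<^sub>0 real))"
  by (rule linearI) (simp_all add: pm_mult_scaleR_right distrib_left)


section \<open>Algebra homomorphisms, subalgebras, ideals\<close>

definition algebra_hom :: "('a::real_algebra_1 \<Rightarrow> 'b::real_algebra_1) \<Rightarrow> bool" where
  "algebra_hom f \<longleftrightarrow> linear f \<and> f 1 = 1 \<and> (\<forall>x y. f (x * y) = f x * f y)"

inductive_set generated_subalgebra :: "'a::real_algebra_1 set \<Rightarrow> 'a set" for G where
  one: "1 \<in> generated_subalgebra G"
| gen: "g \<in> G \<Longrightarrow> g \<in> generated_subalgebra G"
| add: "x \<in> generated_subalgebra G \<Longrightarrow> y \<in> generated_subalgebra G \<Longrightarrow> x + y \<in> generated_subalgebra G"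
| scale: "x \<in> generated_subalgebra G \<Longrightarrow> c *\<^sub>R x \<in> generated_subalgebra G"
| mult: "x \<in> generated_subalgebra G \<Longrightarrow> y \<in> generated_subalgebra G \<Longrightarrow> x * y \<in> generated_subalgebra G"

definition two_sided_ideal :: "('a::monoid_add \<Rightarrow>\<^sub>0 real) set \<Rightarrow> ('a \<Rightarrow>\<^sub>0 real) set" where
  "two_sided_ideal R = span {a * r * b | a r b. r \<in> R}"

lemma span_mult_left_closed:
  fixes G :: "('a::monoid_add \<Rightarrow>\<^sub>0 real) set"
  assumes "\<And>k g. g \<in> G \<Longrightarrow> Poly_Mapping.single k 1 * g \<in> span G" and x: "x \<in> span G"
  shows "a * x \<in> span G"
proof -
  have "Poly_Mapping.single k 1 * x \<in> span G" for k
    using x by (rule span_induct)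
      (use assms(1) in \<open>auto simp: subspace_def distrib_left pm_mult_scaleR_right span_zero span_add span_scale\<close>)
  then have "(\<Sum>k\<in>Poly_Mapping.keys a. poly_mapping.lookup a k *\<^sub>R (Poly_Mapping.single k 1 * x)) \<in> span G"
    by (intro span_sum span_scale)
  also have "(\<Sum>k\<in>Poly_Mapping.keys a. poly_mapping.lookup a k *\<^sub>R (Poly_Mapping.single k 1 * x)) = a * x"
    by (subst (3) pm_expand) (simp only: sum_distrib_right pm_mult_scaleR_left)
  finally show ?thesis .
qed

lemma span_mult_right_closed:
  fixes G :: "('a::monoid_add \<Rightarrow>\<^sub>0 real) set"
  assumes "\<And>k g. g \<in> G \<Longrightarrow> g * Poly_Mapping.single k 1 \<in> span G" and x: "x \<in> span G"
  shows "x * a \<in> span G"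
proof -
  have "x * Poly_Mapping.single k 1 \<in> span G" for k
    using x by (rule span_induct)
      (use assms(1) in \<open>auto simp: subspace_def distrib_right pm_mult_scaleR_left span_zero span_add span_scale\<close>)
  then have "(\<Sum>k\<in>Poly_Mapping.keys a. poly_mapping.lookup a k *\<^sub>R (x * Poly_Mapping.single k 1)) \<in> span G"
    by (intro span_sum span_scale)
  also have "(\<Sum>k\<in>Poly_Mapping.keys a. poly_mapping.lookup a k *\<^sub>R (x * Poly_Mapping.single k 1)) = x * a"
    by (subst (3) pm_expand) (simp only: sum_distrib_left pm_mult_scaleR_right)
  finally show ?thesis .
qed

lemma ideal_mult_left: "x \<in> two_sided_ideal R \<Longrightarrow> a * x \<in> two_sided_ideal R"
  unfolding two_sided_ideal_def
proof (rule span_mult_left_closed, goal_cases)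
  case (1 k g)
  then obtain a r b where "r \<in> R" "g = a * r * b" by auto
  then have "Poly_Mapping.single k 1 * g = (Poly_Mapping.single k 1 * a) * r * b"
    by (simp add: mult.assoc)
  with \<open>r \<in> R\<close> show ?case by (intro span_base) blast
qed

lemma ideal_mult_right: "x \<in> two_sided_ideal R \<Longrightarrow> x * a \<in> two_sided_ideal R"
  unfolding two_sided_ideal_def
proof (rule span_mult_right_closed, goal_cases)
  case (1 k g)
  then obtain a r b where "r \<in> R" "g = a * r * b" by auto
  then have "g * Poly_Mapping.single k 1 = a * r * (b * Poly_Mapping.single k 1)"
    by (simp add: mult.assoc)
  with \<open>r \<in> R\<close> show ?case by (intro span_base) blast
qed


section \<open>Tensor products of real algebras\<close>

text \<open>
  \<open>A \<otimes> B\<close> is the free vector space on the set of pairs, modulo the span of the bilinearity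
  relations. The pairs form a monoid under componentwise multiplication, so that the
  product of the monoid algebra is the bilinear extension of
  \<open>(a \<otimes> b) (c \<otimes> d) = a c \<otimes> b d\<close>.
\<close>

datatype ('a, 'b) pure = Pure (pfst: 'a) (psnd: 'b)

instantiation pure :: (monoid_mult, monoid_mult) monoid_add
begin
definition "0 = Pure 1 1"
definition "p + q = Pure (pfst p * pfst q) (psnd p * psnd q)"
instance by standard (auto simp: zero_pure_def plus_pure_def mult.assoc)
end

abbreviation free_pure :: "'a \<Rightarrow> 'b \<Rightarrow> ('a, 'b) pure \<Rightarrow>\<^sub>0 real" where
  "free_pure a b \<equiv> Poly_Mapping.single (Pure a b) 1"

definition bilinear_relators :: "(('a::real_vector, 'b::real_vector) pure \<Rightarrow>\<^sub>0 real) set" where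
  "bilinear_relators =
     {free_pure (a + a') b - free_pure a b - free_pure a' b | a a' b. True} \<union>
     {free_pure a (b + b') - free_pure a b - free_pure a b' | a b b'. True} \<union>
     {free_pure (c *\<^sub>R a) b - c *\<^sub>R free_pure a b | a b c. True} \<union>
     {free_pure a (c *\<^sub>R b) - c *\<^sub>R free_pure a b | a b c. True}"

lemma free_pure_mult: 
  "free_pure a b * free_pure c d = free_pure (a * c) (b * (d :: 'b::monoid_mult) :: 'b)"
  for a c :: "'a::monoid_mult"
  by (simp add: mult_single plus_pure_def)

lemma bilinear_relators_mult_left:
  fixes x :: "('a::real_algebra_1, 'b::real_algebra_1) pure \<Rightarrow>\<^sub>0 real"
  assumes "x \<in> span bilinear_relators"
  shows "y * x \<in> span bilinear_relators"
  using _ assms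
proof (rule span_mult_left_closed)
  fix k and g :: "('a, 'b) pure \<Rightarrow>\<^sub>0 real"
  assume "g \<in> bilinear_relators"
  then have "free_pure c d * g \<in> bilinear_relators" for c d
    unfolding bilinear_relators_def Un_iff
    by (elim disjE CollectE exE conjE; hypsubst;
        simp only: right_diff_distrib free_pure_mult pm_mult_scaleR_right distrib_left
          mult_scaleR_right) blast+
  then have "Poly_Mapping.single k 1 * g \<in> bilinear_relators" by (cases k) simp
  then show "Poly_Mapping.single k 1 * g \<in> span bilinear_relators" by (rule span_base)
qed

lemma bilinear_relators_mult_right:
  fixes x :: "('a::real_algebra_1, 'b::real_algebra_1) pure \<Rightarrow>\<^sub>0 real"
  assumes "x \<in> span bilinear_relators"
  shows "x * y \<in> span bilinear_relators"
  using _ assms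
proof (rule span_mult_right_closed)
  fix k and g :: "('a, 'b) pure \<Rightarrow>\<^sub>0 real"
  assume "g \<in> bilinear_relators"
  then have "g * free_pure c d \<in> bilinear_relators" for c d
    unfolding bilinear_relators_def Un_iff
    by (elim disjE CollectE exE conjE; hypsubst;
        simp only: left_diff_distrib free_pure_mult pm_mult_scaleR_left distrib_right
          mult_scaleR_left) blast+
  then have "g * Poly_Mapping.single k 1 \<in> bilinear_relators" by (cases k) simp
  then show "g * Poly_Mapping.single k 1 \<in> span bilinear_relators" by (rule span_base)
qed

lemma lin_ext_bilinear_relators:
  assumes "bilinear \<beta>" "x \<in> span bilinear_relators"
  shows "lin_ext (\<lambda>p. \<beta> (pfst p) (psnd p)) x = 0"
proof -
  interpret linear "lin_ext (\<lambda>p. \<beta> (pfst p) (psnd p))" by (rule linear_lin_ext)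
  show ?thesis using assms(2)
    by (rule linear_eq_0_on_span[OF linear_axioms, rotated])
       (auto simp: bilinear_relators_def diff scale bilinear_ladd[OF assms(1)] bilinear_radd[OF assms(1)]
          bilinear_lmul[OF assms(1)] bilinear_rmul[OF assms(1)])
qed

quotient_type (overloaded) ('a, 'b) tensor =
  "('a::real_algebra_1, 'b::real_algebra_1) pure \<Rightarrow>\<^sub>0 real" /
  "\<lambda>x y. x - y \<in> span bilinear_relators"
proof (rule equivpI)
  show "reflp (\<lambda>x y :: ('a, 'b) pure \<Rightarrow>\<^sub>0 real. x - y \<in> span bilinear_relators)"
    by (simp add: reflp_def span_zero)
  show "symp (\<lambda>x y :: ('a, 'b) pure \<Rightarrow>\<^sub>0 real. x - y \<in> span bilinear_relators)"
    by (rule sympI) (subst minus_diff_eq[symmetric], erule span_neg)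
  show "transp (\<lambda>x y :: ('a, 'b) pure \<Rightarrow>\<^sub>0 real. x - y \<in> span bilinear_relators)"
    by (rule transpI) (drule (1) span_add, simp)
qed

lemma quotient_diff_mult:
  fixes a :: "'a::ring"
  shows "a * b - c * d = a * (b - d) + (a - c) * d"
  by (simp add: algebra_simps)

lemma exists_linear_one: "\<exists>f :: 'a::real_algebra_1 \<Rightarrow> real. linear f \<and> f 1 = 1"
proof -
  have "independent {1::'a}" by simp
  from linear_independent_extend[OF this, of "\<lambda>_. 1"] show ?thesis by auto
qed

lemma one_notin_span_bilinear_relators:
  "(1 :: ('a::real_algebra_1, 'b::real_algebra_1) pure \<Rightarrow>\<^sub>0 real) \<notin> span bilinear_relators"
proof
  obtain f :: "'a \<Rightarrow> real" and g :: "'b \<Rightarrow> real" where fg: "linear f" "f 1 = 1" "linear g" "g 1 = 1"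
    using exists_linear_one[where 'a='a] exists_linear_one[where 'a='b] by blast
  have "bilinear (\<lambda>a b. f a * g b)"
    unfolding bilinear_def using fg
    by (auto intro!: linearI simp: linear_add linear_scale algebra_simps)
  moreover assume "(1 :: ('a, 'b) pure \<Rightarrow>\<^sub>0 real) \<in> span bilinear_relators"
  ultimately have "lin_ext (\<lambda>p. f (pfst p) * g (psnd p)) 1 = 0"
    by (rule lin_ext_bilinear_relators)
  then have "lin_ext (\<lambda>p. f (pfst p) * g (psnd p)) (Poly_Mapping.single 0 1) = 0"
    by simp
  then show False by (simp only: lin_ext_single) (simp add: zero_pure_def fg)
qed

instantiation tensor :: (real_algebra_1, real_algebra_1) real_algebra_1
begin

lift_definition zero_tensor :: "('a, 'b) tensor" is 0 .

lift_definition one_tensor :: "('a, 'b) tensor" is 1 .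

lift_definition plus_tensor :: "('a, 'b) tensor \<Rightarrow> ('a, 'b) tensor \<Rightarrow> ('a, 'b) tensor" is "(+)"
  by (drule (1) span_add) (simp add: algebra_simps)

lift_definition minus_tensor :: "('a, 'b) tensor \<Rightarrow> ('a, 'b) tensor \<Rightarrow> ('a, 'b) tensor" is "(-)"
  by (drule (1) span_diff) (simp add: algebra_simps)

lift_definition uminus_tensor :: "('a, 'b) tensor \<Rightarrow> ('a, 'b) tensor" is uminus
  by (drule span_neg) (simp add: algebra_simps)

lift_definition scaleR_tensor :: "real \<Rightarrow> ('a, 'b) tensor \<Rightarrow> ('a, 'b) tensor" is scaleR
  by (drule span_scale) (simp add: algebra_simps)

lift_definition times_tensor :: "('a, 'b) tensor \<Rightarrow> ('a, 'b) tensor \<Rightarrow> ('a, 'b) tensor" is "(*)"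
  by (subst quotient_diff_mult)
     (intro span_add bilinear_relators_mult_left bilinear_relators_mult_right)

instance
proof
  show "(0 :: ('a, 'b) tensor) \<noteq> 1"
    by transfer (use one_notin_span_bilinear_relators span_neg in force)
qed (transfer, simp add: algebra_simps pm_mult_scaleR_left pm_mult_scaleR_right span_zero)+

end

lift_definition tprod :: "'a::real_algebra_1 \<Rightarrow> 'b::real_algebra_1 \<Rightarrow> ('a, 'b) tensor"
  (infixr \<open>\<otimes>\<^sub>t\<close> 75) is free_pure .

lemma tprod_add_left: "(a + a') \<otimes>\<^sub>t b = a \<otimes>\<^sub>t b + a' \<otimes>\<^sub>t b"
  by transfer (rule span_base, unfold bilinear_relators_def diff_diff_eq[symmetric], blast)

lemma tprod_add_right: "a \<otimes>\<^sub>t (b + b') = a \<otimes>\<^sub>t b + a \<otimes>\<^sub>t b'"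
  by transfer (rule span_base, unfold bilinear_relators_def diff_diff_eq[symmetric], blast)

lemma tprod_scaleR_left: "(c *\<^sub>R a) \<otimes>\<^sub>t b = c *\<^sub>R (a \<otimes>\<^sub>t b)"
  by transfer (rule span_base, unfold bilinear_relators_def, blast)

lemma tprod_scaleR_right: "a \<otimes>\<^sub>t (c *\<^sub>R b) = c *\<^sub>R (a \<otimes>\<^sub>t b)"
  by transfer (rule span_base, unfold bilinear_relators_def, blast)

lemma bilinear_tprod: "bilinear (\<otimes>\<^sub>t)"
  unfolding bilinear_def
  by (auto intro!: linearI simp: tprod_add_left tprod_add_right tprod_scaleR_left tprod_scaleR_right)

lemma tprod_mult: "(a \<otimes>\<^sub>t b) * (c \<otimes>\<^sub>t d) = (a * c) \<otimes>\<^sub>t (b * d)"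
  by transfer (simp add: free_pure_mult span_zero)

lemma tprod_one: "1 \<otimes>\<^sub>t 1 = 1"
  by transfer (simp add: span_zero flip: single_one zero_pure_def)

lemma tensor_expand: "\<exists>ps. t = (\<Sum>(a, b)\<leftarrow>ps. a \<otimes>\<^sub>t b)"
proof -
  obtain x where t: "t = abs_tensor x" by (induct t) auto
  have "\<exists>ps. abs_tensor x = (\<Sum>(a, b)\<leftarrow>ps. a \<otimes>\<^sub>t b)"
  proof -
    have x: "x \<in> span (range (\<lambda>k. Poly_Mapping.single k 1))" by (simp add: span_singles)
    show ?thesis using x
    proof (induction rule: span_induct_alt)
      case base
      show ?case by (rule exI[of _ "[]"]) (simp add: zero_tensor.abs_eq)
    next
      case (step c g y)
      then obtain k ps where "g = Poly_Mapping.single k 1"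
        and ps: "abs_tensor y = (\<Sum>(a, b)\<leftarrow>ps. a \<otimes>\<^sub>t b)" by auto
      then have "abs_tensor g = pfst k \<otimes>\<^sub>t psnd k" by (simp add: tprod.abs_eq)
      then have "abs_tensor (c *\<^sub>R g + y) = (c *\<^sub>R pfst k) \<otimes>\<^sub>t psnd k + abs_tensor y"
        by (simp add: tprod_scaleR_left flip: scaleR_tensor.abs_eq plus_tensor.abs_eq)
      then show ?case using ps by (intro exI[of _ "(c *\<^sub>R pfst k, psnd k) # ps"]) simp
    qed
  qed
  with t show ?thesis by simp
qed

definition tensor_lift ::
    "('a::real_algebra_1 \<Rightarrow> 'b::real_algebra_1 \<Rightarrow> 'c::real_vector) \<Rightarrow> ('a, 'b) tensor \<Rightarrow> 'c" where
  "tensor_lift \<beta> t = lin_ext (\<lambda>p. \<beta> (pfst p) (psnd p)) (rep_tensor t)"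

lemma tensor_lift_abs:
  assumes "bilinear \<beta>"
  shows "tensor_lift \<beta> (abs_tensor x) = lin_ext (\<lambda>p. \<beta> (pfst p) (psnd p)) x"
proof -
  have "rep_tensor (abs_tensor x) - x \<in> span bilinear_relators"
    using Quotient_rep_abs[OF Quotient_tensor, of x] by (simp add: span_zero)
  from lin_ext_bilinear_relators[OF assms this] show ?thesis
    by (simp add: tensor_lift_def linear_diff[OF linear_lin_ext])
qed

lemma tensor_lift_tprod: "bilinear \<beta> \<Longrightarrow> tensor_lift \<beta> (a \<otimes>\<^sub>t b) = \<beta> a b"
  by (simp add: tprod.abs_eq tensor_lift_abs)

lemma linear_tensor_lift:
  assumes "bilinear \<beta>"
  shows "linear (tensor_lift \<beta>)"
proof (rule linearI)
  fix s t and c :: real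
  show "tensor_lift \<beta> (s + t) = tensor_lift \<beta> s + tensor_lift \<beta> t"
    by (induct s; induct t)
       (simp add: plus_tensor.abs_eq tensor_lift_abs[OF assms] linear_add[OF linear_lin_ext])
  show "tensor_lift \<beta> (c *\<^sub>R s) = c *\<^sub>R tensor_lift \<beta> s"
    by (induct s)
       (simp add: scaleR_tensor.abs_eq tensor_lift_abs[OF assms] linear_scale[OF linear_lin_ext])
qed


section \<open>The Connes--Moscovici Hopf algebra\<close>

text \<open>\<open>BD m\<close> is the basis vector \<open>\<delta>\<close> of index \<open>m + 1\<close>.\<close>

datatype cm_basis = BY | BX | BD nat

fun basis_bracket :: "cm_basis \<Rightarrow> cm_basis \<Rightarrow> (cm_basis \<Rightarrow>\<^sub>0 real)" where
  "basis_bracket BY BX = Poly_Mapping.single BX 1"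
| "basis_bracket BX BY = - Poly_Mapping.single BX 1"
| "basis_bracket BY (BD m) = Poly_Mapping.single (BD m) (real (m + 1))"
| "basis_bracket (BD m) BY = - Poly_Mapping.single (BD m) (real (m + 1))"
| "basis_bracket BX (BD m) = Poly_Mapping.single (BD (m + 1)) 1"
| "basis_bracket (BD m) BX = - Poly_Mapping.single (BD (m + 1)) 1"
| "basis_bracket _ _ = 0"

definition cm_bracket ::
    "(cm_basis \<Rightarrow>\<^sub>0 real) \<Rightarrow> (cm_basis \<Rightarrow>\<^sub>0 real) \<Rightarrow> (cm_basis \<Rightarrow>\<^sub>0 real)" where
  "cm_bracket x y = lin_ext (\<lambda>a. lin_ext (basis_bracket a) y) x"

lemma cm_bracket_single [simp]:
  "cm_bracket (Poly_Mapping.single a r) (Poly_Mapping.single b s) = (r * s) *\<^sub>R basis_bracket a b"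
  by (simp add: cm_bracket_def)

lemma linear_cm_bracket_left: "linear (\<lambda>x. cm_bracket x y)"
  unfolding cm_bracket_def by (rule linear_lin_ext)

lemma linear_cm_bracket_right: "linear (cm_bracket x)"
  unfolding cm_bracket_def lin_ext_def[of _ x]
  by (intro linear_compose_sum ballI linear_compose_scale_right linear_lin_ext)

lemma bilinear_cm_bracket: "bilinear cm_bracket"
  by (simp add: bilinear_def linear_cm_bracket_left linear_cm_bracket_right)

lemma cm_bracket_anticomm: "cm_bracket x y = - cm_bracket y x"
proof -
  note lin = linear_compose_neg[OF linear_cm_bracket_right] linear_compose_neg[OF linear_cm_bracket_left]
  have anti: "basis_bracket a b = - basis_bracket b a" for a b
    by (cases "(a, b)" rule: basis_bracket.cases) auto
  have "cm_bracket (Poly_Mapping.single a 1) y = - cm_bracket y (Poly_Mapping.single a 1)" for a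
  proof (rule linear_eq_on_singles[OF linear_cm_bracket_right lin(2)])
    fix b
    show "cm_bracket (Poly_Mapping.single a 1) (Poly_Mapping.single b 1) =
        - cm_bracket (Poly_Mapping.single b 1) (Poly_Mapping.single a 1)"
      using anti[of a b] by simp
  qed
  then show ?thesis
    by (rule linear_eq_on_singles[OF linear_cm_bracket_left lin(1)])
qed

lemma cm_bracket_self: "cm_bracket x x = 0"
proof -
  have "2 *\<^sub>R cm_bracket x x = 0"
    using cm_bracket_anticomm[of x x] by (simp only: scaleR_2 eq_neg_iff_add_eq_0)
  then show ?thesis by simp
qed

lemma cm_bracket_jacobi:
  "cm_bracket x (cm_bracket y z) + cm_bracket y (cm_bracket z x) + cm_bracket z (cm_bracket x y) = 0"
  (is "?J x y z = 0")
proof -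
  note lin = linear_cm_bracket_left linear_cm_bracket_right
    linear_compose[OF linear_cm_bracket_left linear_cm_bracket_right, unfolded o_def]
    linear_compose[OF linear_cm_bracket_right linear_cm_bracket_right, unfolded o_def]
  have lin1: "linear (\<lambda>x. ?J x y z)" for y z by (intro linear_compose_add lin)
  have lin2: "linear (\<lambda>y. ?J x y z)" for x z by (intro linear_compose_add lin)
  have lin3: "linear (\<lambda>z. ?J x y z)" for x y by (intro linear_compose_add lin)
  let ?s = "\<lambda>a. Poly_Mapping.single a (1::real)"
  have neg: "cm_bracket p (- q) = - cm_bracket p q" for p q
    by (rule linear_neg[OF linear_cm_bracket_right])
  have zero: "cm_bracket p 0 = 0" for p
    by (rule linear_0[OF linear_cm_bracket_right])
  have "?J (?s a) (?s b) (?s c) = 0" for a b c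
    by (cases a; cases b; cases c)
       (simp_all add: neg zero algebra_simps scaleR_2 flip: single_scaleR single_add)
  then have "?J (?s a) (?s b) z = 0" for a b z
    by (rule_tac linear_eq_on_singles[OF lin3 linear_zero])
  then have "?J (?s a) y z = 0" for a y z
    by (rule_tac linear_eq_on_singles[OF lin2 linear_zero])
  then show ?thesis
    by (rule linear_eq_on_singles[OF lin1 linear_zero])
qed

datatype 'a word = Word "'a list"

instantiation word :: (type) monoid_add
begin
definition "0 = Word []"
fun plus_word where "Word xs + Word ys = Word (xs @ ys)"
instance
proof
  fix u v w :: "'a word"
  show "u + v + w = u + (v + w)" by (cases u; cases v; cases w) simp
  show "0 + u = u" "u + 0 = u" by (cases u; simp add: zero_word_def)+
qed
end

text \<open>
  The tensor algebra of the Lie algebra is the free algebra \<open>cm_basis word \<Rightarrow>\<^sub>0 real\<close> on its basis,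
  \<open>lie_emb\<close> being the inclusion of the Lie algebra.
\<close>

definition lie_emb :: "(cm_basis \<Rightarrow>\<^sub>0 real) \<Rightarrow> (cm_basis word \<Rightarrow>\<^sub>0 real)" where
  "lie_emb = lin_ext (\<lambda>b. Poly_Mapping.single (Word [b]) 1)"

definition enveloping_relators :: "(cm_basis word \<Rightarrow>\<^sub>0 real) set" where
  "enveloping_relators =
     {lie_emb x * lie_emb y - lie_emb y * lie_emb x - lie_emb (cm_bracket x y) | x y. True}"

subsection \<open>Extending maps on the basis\<close>

text \<open>
  The product \<open>m\<close> is multiplication for homomorphisms and its opposite for antihomomorphisms.
\<close>

fun word_prod :: "('b \<Rightarrow> 'b \<Rightarrow> 'b) \<Rightarrow> 'b \<Rightarrow> ('a \<Rightarrow> 'b) \<Rightarrow> 'a word \<Rightarrow> 'b" where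
  "word_prod m e \<phi> (Word bs) = foldr (\<lambda>b. m (\<phi> b)) bs e"

locale cm_rep =
  fixes m :: "'b \<Rightarrow> 'b \<Rightarrow> 'b::real_vector" and e :: 'b and \<phi> :: "cm_basis \<Rightarrow> 'b"
  assumes bil: "bilinear m"
    and assoc: "m (m x y) z = m x (m y z)"
    and unit: "m e x = x" "m x e = x"
    and rel: "m (\<phi> a) (\<phi> b) - m (\<phi> b) (\<phi> a) = lin_ext \<phi> (basis_bracket a b)"
begin

definition free_lift :: "(cm_basis word \<Rightarrow>\<^sub>0 real) \<Rightarrow> 'b" where
  "free_lift = lin_ext (word_prod m e \<phi>)"

lemma linear_free_lift: "linear free_lift"
  unfolding free_lift_def by (rule linear_lin_ext)

lemma lin_m: "linear (m x)" "linear (\<lambda>x. m x y)"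
  using bil by (auto simp: bilinear_def)

lemma word_prod_append: "word_prod m e \<phi> (v + w) = m (word_prod m e \<phi> v) (word_prod m e \<phi> w)"
proof (cases v; cases w)
  fix xs ys assume "v = Word xs" "w = Word ys"
  moreover have "foldr (\<lambda>b. m (\<phi> b)) xs z = m (foldr (\<lambda>b. m (\<phi> b)) xs e) z" for z
    by (induction xs) (auto simp: unit assoc)
  from this[of "foldr (\<lambda>b. m (\<phi> b)) ys e"]
  have "foldr (\<lambda>b. m (\<phi> b)) (xs @ ys) e =
      m (foldr (\<lambda>b. m (\<phi> b)) xs e) (foldr (\<lambda>b. m (\<phi> b)) ys e)"
    by simp
  ultimately show ?thesis by (simp only: plus_word.simps word_prod.simps)
qed

lemma free_lift_one: "free_lift 1 = e"
  by (simp add: free_lift_def zero_word_def flip: single_one)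

lemma free_lift_mult: "free_lift (x * y) = m (free_lift x) (free_lift y)"
proof -
  let ?s = "\<lambda>a. Poly_Mapping.single a (1::real)"
  have l1: "linear (\<lambda>x. free_lift (x * y))" for y
    using linear_compose[OF linear_pm_times_left linear_free_lift] by (simp add: o_def)
  have l2: "linear (\<lambda>y. free_lift (x * y))" for x
    using linear_compose[OF linear_pm_times_right linear_free_lift] by (simp add: o_def)
  have r1: "linear (\<lambda>x. m (free_lift x) z)" for z
    using linear_compose[OF linear_free_lift lin_m(2)] by (simp add: o_def)
  have r2: "linear (\<lambda>y. m z (free_lift y))" for z
    using linear_compose[OF linear_free_lift lin_m(1)] by (simp add: o_def)
  have "free_lift (?s v * ?s w) = m (free_lift (?s v)) (free_lift (?s w))" for v w
    by (simp add: free_lift_def mult_single word_prod_append)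
  then have "free_lift (?s v * y) = m (free_lift (?s v)) (free_lift y)" for v
    by (rule_tac linear_eq_on_singles[OF l2 r2])
  then show ?thesis
    by (rule linear_eq_on_singles[OF l1 r1])
qed

lemma free_lift_lie_emb: "free_lift (lie_emb x) = lin_ext \<phi> x"
proof -
  have "linear (\<lambda>x. free_lift (lie_emb x))"
    using linear_compose[OF linear_lin_ext linear_free_lift] by (simp add: o_def lie_emb_def)
  from linear_eq_on_singles[OF this linear_lin_ext] show ?thesis
    by (simp add: lie_emb_def free_lift_def unit)
qed

lemma lin_ext_cm_bracket:
  "lin_ext \<phi> (cm_bracket x y) = m (lin_ext \<phi> x) (lin_ext \<phi> y) - m (lin_ext \<phi> y) (lin_ext \<phi> x)"
proof -
  let ?s = "\<lambda>a. Poly_Mapping.single a (1::real)"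
  have l: "linear (\<lambda>x. lin_ext \<phi> (cm_bracket x y))" "linear (\<lambda>x. lin_ext \<phi> (cm_bracket y x))" for y
    using linear_compose[OF linear_cm_bracket_left linear_lin_ext]
      linear_compose[OF linear_cm_bracket_right linear_lin_ext] by (simp_all add: o_def)
  have r: "linear (\<lambda>x. m (lin_ext \<phi> x) z)" "linear (\<lambda>x. m z (lin_ext \<phi> x))" for z
    using linear_compose[OF linear_lin_ext lin_m(1)] linear_compose[OF linear_lin_ext lin_m(2)]
    by (simp_all add: o_def)
  note rr = linear_compose_sub[OF r(1) r(2)] linear_compose_sub[OF r(2) r(1)]
  have "lin_ext \<phi> (cm_bracket (?s a) (?s b)) =
      m (lin_ext \<phi> (?s a)) (lin_ext \<phi> (?s b)) - m (lin_ext \<phi> (?s b)) (lin_ext \<phi> (?s a))" for a b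
    by (simp add: rel)
  then have "lin_ext \<phi> (cm_bracket (?s a) y) =
      m (lin_ext \<phi> (?s a)) (lin_ext \<phi> y) - m (lin_ext \<phi> y) (lin_ext \<phi> (?s a))" for a
    by (rule_tac linear_eq_on_singles[OF l(2) rr(2)])
  then show ?thesis
    by (rule linear_eq_on_singles[OF l(1) rr(1)])
qed

lemma free_lift_ideal:
  assumes "x \<in> two_sided_ideal enveloping_relators"
  shows "free_lift x = 0"
proof (rule linear_eq_0_on_span[OF linear_free_lift _ assms[unfolded two_sided_ideal_def]])
  fix x assume "x \<in> {a * r * b | a r b. r \<in> enveloping_relators}"
  then obtain a r b where x: "x = a * r * b" and "r \<in> enveloping_relators" by blast
  then obtain u v where "r = lie_emb u * lie_emb v - lie_emb v * lie_emb u - lie_emb (cm_bracket u v)"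
    by (auto simp: enveloping_relators_def)
  then have "free_lift r = 0"
    by (simp add: linear_diff[OF linear_free_lift] free_lift_mult free_lift_lie_emb lin_ext_cm_bracket)
  then show "free_lift x = 0"
    by (simp add: x free_lift_mult linear_0[OF lin_m(1)] linear_0[OF lin_m(2)])
qed

end

lemma one_notin_enveloping_ideal: "1 \<notin> two_sided_ideal enveloping_relators"
proof -
  interpret cm_rep "(*) :: real \<Rightarrow> real \<Rightarrow> real" 1 "\<lambda>_. 0"
    by unfold_locales (auto simp: bilinear_def lin_ext_def algebra_simps intro!: linearI)
  show ?thesis using free_lift_ideal[of 1] free_lift_one by auto
qed

subsection \<open>The enveloping algebra\<close>

quotient_type hcm = "cm_basis word \<Rightarrow>\<^sub>0 real" / "\<lambda>x y. x - y \<in> two_sided_ideal enveloping_relators"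
proof (rule equivpI)
  show "reflp (\<lambda>x y. x - y \<in> two_sided_ideal enveloping_relators)"
    by (simp add: reflp_def span_zero two_sided_ideal_def)
  show "symp (\<lambda>x y. x - y \<in> two_sided_ideal enveloping_relators)"
    unfolding two_sided_ideal_def
    by (rule sympI) (subst minus_diff_eq[symmetric], erule span_neg)
  show "transp (\<lambda>x y. x - y \<in> two_sided_ideal enveloping_relators)"
    unfolding two_sided_ideal_def by (rule transpI) (drule (1) span_add, simp)
qed

lemma ideal_closed:
  "0 \<in> two_sided_ideal R"
  "x \<in> two_sided_ideal R \<Longrightarrow> y \<in> two_sided_ideal R \<Longrightarrow> x + y \<in> two_sided_ideal R"
  "x \<in> two_sided_ideal R \<Longrightarrow> y \<in> two_sided_ideal R \<Longrightarrow> x - y \<in> two_sided_ideal R"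
  "x \<in> two_sided_ideal R \<Longrightarrow> - x \<in> two_sided_ideal R"
  "x \<in> two_sided_ideal R \<Longrightarrow> c *\<^sub>R x \<in> two_sided_ideal R"
  unfolding two_sided_ideal_def by (auto intro: span_zero span_add span_diff span_neg span_scale)

instantiation hcm :: real_algebra_1
begin

lift_definition zero_hcm :: hcm is 0 .

lift_definition one_hcm :: hcm is 1 .

lift_definition plus_hcm :: "hcm \<Rightarrow> hcm \<Rightarrow> hcm" is "(+)"
  by (drule (1) ideal_closed(2)) (simp add: algebra_simps)

lift_definition minus_hcm :: "hcm \<Rightarrow> hcm \<Rightarrow> hcm" is "(-)"
  by (drule (1) ideal_closed(3)) (simp add: algebra_simps)

lift_definition uminus_hcm :: "hcm \<Rightarrow> hcm" is uminus
  by (drule ideal_closed(4)) (simp add: algebra_simps)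

lift_definition scaleR_hcm :: "real \<Rightarrow> hcm \<Rightarrow> hcm" is scaleR
  by (drule ideal_closed(5)) (simp add: algebra_simps)

lift_definition times_hcm :: "hcm \<Rightarrow> hcm \<Rightarrow> hcm" is "(*)"
  by (subst quotient_diff_mult) (intro ideal_closed(2) ideal_mult_left ideal_mult_right)

instance
proof
  show "(0 :: hcm) \<noteq> 1"
    by transfer (use one_notin_enveloping_ideal ideal_closed(4) in force)
qed (transfer, simp add: algebra_simps pm_mult_scaleR_left pm_mult_scaleR_right ideal_closed)+

end

lift_definition lie_to_hcm :: "(cm_basis \<Rightarrow>\<^sub>0 real) \<Rightarrow> hcm" is lie_emb .

definition cm_Y :: hcm where "cm_Y = lie_to_hcm (Poly_Mapping.single BY 1)"

definition cm_X :: hcm where "cm_X = lie_to_hcm (Poly_Mapping.single BX 1)"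

text \<open>Only meaningful for \<open>n \<ge> 1\<close>.\<close>

definition cm_delta :: "nat \<Rightarrow> hcm" where
  "cm_delta n = lie_to_hcm (Poly_Mapping.single (BD (n - 1)) 1)"

text \<open>The Hopf algebra structure; \<open>coproduct_ex1\<close> and \<open>counit_ex1\<close> below show that it is well-defined.\<close>

definition coproduct_spec :: "(hcm \<Rightarrow> (hcm, hcm) tensor) \<Rightarrow> bool" where
  "coproduct_spec \<Delta> \<longleftrightarrow> algebra_hom \<Delta> \<and>
     \<Delta> cm_Y = cm_Y \<otimes>\<^sub>t 1 + 1 \<otimes>\<^sub>t cm_Y \<and>
     \<Delta> cm_X = cm_X \<otimes>\<^sub>t 1 + 1 \<otimes>\<^sub>t cm_X + cm_delta 1 \<otimes>\<^sub>t cm_Y \<and>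
     \<Delta> (cm_delta 1) = cm_delta 1 \<otimes>\<^sub>t 1 + 1 \<otimes>\<^sub>t cm_delta 1"

definition coproduct :: "hcm \<Rightarrow> (hcm, hcm) tensor" where
  "coproduct = (THE \<Delta>. coproduct_spec \<Delta>)"

definition counit_spec :: "(hcm \<Rightarrow> real) \<Rightarrow> bool" where
  "counit_spec \<epsilon> \<longleftrightarrow> algebra_hom \<epsilon> \<and> \<epsilon> cm_Y = 0 \<and> \<epsilon> cm_X = 0 \<and> (\<forall>n\<ge>1. \<epsilon> (cm_delta n) = 0)"

definition counit :: "hcm \<Rightarrow> real" where
  "counit = (THE \<epsilon>. counit_spec \<epsilon>)"

definition hcm1 :: "hcm set" where
  "hcm1 = generated_subalgebra {cm_delta n | n. n \<ge> 1}"

text \<open>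
  \<open>S\<close> is an antipode of the sub-Hopf algebra \<open>A\<close>: the two-sided convolution inverse of the inclusion,
  \<open>\<Sum> S(h') h'' = \<epsilon>(h) 1 = \<Sum> h' S(h'')\<close>. Representing \<open>\<Delta> h\<close> by pairs from \<open>A\<close> expresses
  \<open>S \<otimes> id\<close> and \<open>id \<otimes> S\<close> on \<open>A \<otimes> A\<close>, so that \<open>S\<close> need only be defined on \<open>A\<close>.
\<close>

definition antipode_on ::
    "'a::real_algebra_1 set \<Rightarrow> ('a \<Rightarrow> ('a, 'a) tensor) \<Rightarrow> ('a \<Rightarrow> real) \<Rightarrow> ('a \<Rightarrow> 'a) \<Rightarrow> bool" where
  "antipode_on A \<Delta> \<epsilon> S \<longleftrightarrow>
     S ` A \<subseteq> A \<and>
     (\<forall>x\<in>A. \<forall>y\<in>A. S (x + y) = S x + S y) \<and>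
     (\<forall>c. \<forall>x\<in>A. S (c *\<^sub>R x) = c *\<^sub>R S x) \<and>
     (\<forall>h\<in>A. \<forall>ps. set ps \<subseteq> A \<times> A \<and> \<Delta> h = (\<Sum>(a, b)\<leftarrow>ps. a \<otimes>\<^sub>t b) \<longrightarrow>
        (\<Sum>(a, b)\<leftarrow>ps. S a * b) = \<epsilon> h *\<^sub>R 1 \<and>
        (\<Sum>(a, b)\<leftarrow>ps. a * S b) = \<epsilon> h *\<^sub>R 1)"

subsection \<open>Well-definedness\<close>

lemma linear_lie_to_hcm: "linear lie_to_hcm"
proof (rule linearI)
  fix x y :: "cm_basis \<Rightarrow>\<^sub>0 real" and c :: real
  have lin: "linear lie_emb" unfolding lie_emb_def by (rule linear_lin_ext)
  show "lie_to_hcm (x + y) = lie_to_hcm x + lie_to_hcm y"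
    by transfer (simp add: linear_add[OF lin] ideal_closed)
  show "lie_to_hcm (c *\<^sub>R x) = c *\<^sub>R lie_to_hcm x"
    by transfer (simp add: linear_scale[OF lin] ideal_closed)
qed

lemma lie_to_hcm_bracket:
  "lie_to_hcm x * lie_to_hcm y - lie_to_hcm y * lie_to_hcm x = lie_to_hcm (cm_bracket x y)"
proof transfer
  fix x y
  let ?r = "lie_emb x * lie_emb y - lie_emb y * lie_emb x - lie_emb (cm_bracket x y)"
  have "1 * ?r * 1 \<in> two_sided_ideal enveloping_relators"
    unfolding two_sided_ideal_def by (rule span_base) (unfold enveloping_relators_def, blast)
  then show "?r \<in> two_sided_ideal enveloping_relators" by simp
qed

lemma hcm_relations:
  "cm_Y * cm_X - cm_X * cm_Y = cm_X"
  "n \<ge> 1 \<Longrightarrow> cm_Y * cm_delta n - cm_delta n * cm_Y = real n *\<^sub>R cm_delta n"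
  "n \<ge> 1 \<Longrightarrow> cm_X * cm_delta n - cm_delta n * cm_X = cm_delta (n + 1)"
  "cm_delta m * cm_delta n = cm_delta n * cm_delta m"
proof -
  show "cm_Y * cm_X - cm_X * cm_Y = cm_X"
    by (simp add: cm_Y_def cm_X_def lie_to_hcm_bracket)
  show "cm_Y * cm_delta n - cm_delta n * cm_Y = real n *\<^sub>R cm_delta n" if "n \<ge> 1"
    using that by (simp add: cm_Y_def cm_delta_def lie_to_hcm_bracket of_nat_diff
        flip: linear_scale[OF linear_lie_to_hcm] single_scaleR)
  show "cm_X * cm_delta n - cm_delta n * cm_X = cm_delta (n + 1)" if "n \<ge> 1"
    using that by (simp add: cm_X_def cm_delta_def lie_to_hcm_bracket)
  have "cm_delta m * cm_delta n - cm_delta n * cm_delta m = 0"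
    by (simp add: cm_delta_def lie_to_hcm_bracket linear_0[OF linear_lie_to_hcm])
  then show "cm_delta m * cm_delta n = cm_delta n * cm_delta m" by simp
qed

lemma hcm_induct_basis:
  assumes gen: "\<And>b. P (lie_to_hcm (Poly_Mapping.single b 1))"
    and one: "P 1"
    and add: "\<And>x y. P x \<Longrightarrow> P y \<Longrightarrow> P (x + y)"
    and scale: "\<And>c x. P x \<Longrightarrow> P (c *\<^sub>R x)"
    and mult: "\<And>x y. P x \<Longrightarrow> P y \<Longrightarrow> P (x * y)"
  shows "P h"
proof -
  have word: "P (abs_hcm (Poly_Mapping.single (Word bs) 1))" for bs
  proof (induction bs)
    case Nil
    have "abs_hcm (Poly_Mapping.single (Word []) 1) = 1"
      by (simp add: one_hcm_def flip: zero_word_def)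
    with one show ?case by simp
  next
    case (Cons b bs)
    have "abs_hcm (Poly_Mapping.single (Word (b # bs)) 1)
        = lie_to_hcm (Poly_Mapping.single b 1) * abs_hcm (Poly_Mapping.single (Word bs) 1)"
      by (simp add: lie_to_hcm.abs_eq times_hcm.abs_eq lie_emb_def mult_single)
    with mult[OF gen Cons.IH] show ?case by simp
  qed
  obtain x where h: "h = abs_hcm x" by (induct h) auto
  have "x \<in> span (range (\<lambda>k. Poly_Mapping.single k 1))" by (simp add: span_singles)
  then have "P (abs_hcm x)"
  proof (induction rule: span_induct_alt)
    case base
    show ?case using scale[OF one, of 0] by (simp add: zero_hcm_def)
  next
    case (step c g y)
    then obtain k where "g = Poly_Mapping.single k 1" by auto
    then have "P (abs_hcm g)" using word by (cases k) simp
    from add[OF scale[OF this, of c] step.IH] show ?case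
      by (simp add: scaleR_hcm.abs_eq plus_hcm.abs_eq)
  qed
  with h show ?thesis by simp
qed

lemma hcm_induct [case_names Y X delta one add scale mult]:
  assumes Y: "P cm_Y" and X: "P cm_X" and delta: "P (cm_delta 1)"
    and one: "P 1"
    and add: "\<And>x y. P x \<Longrightarrow> P y \<Longrightarrow> P (x + y)"
    and scale: "\<And>c x. P x \<Longrightarrow> P (c *\<^sub>R x)"
    and mult: "\<And>x y. P x \<Longrightarrow> P y \<Longrightarrow> P (x * y)"
  shows "P h"
proof (rule hcm_induct_basis[of P, OF _ one add scale mult])
  fix b
  have diff: "P (x - y)" if "P x" "P y" for x y
    using add[OF that(1) scale[OF that(2), of "-1"]] by simp
  have "P (cm_delta (Suc m))" for m
  proof (induction m)
    case (Suc m)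
    have "P (cm_X * cm_delta (Suc m) - cm_delta (Suc m) * cm_X)"
      by (intro diff mult X Suc.IH)
    then show ?case by (simp add: hcm_relations(3))
  qed (use delta in simp)
  then show "P (lie_to_hcm (Poly_Mapping.single b 1))"
    using X Y by (cases b) (simp_all add: cm_delta_def cm_X_def cm_Y_def)
qed

lemma algebra_homD:
  assumes "algebra_hom f"
  shows "f 1 = 1" "f (x + y) = f x + f y" "f (x - y) = f x - f y" "f (c *\<^sub>R x) = c *\<^sub>R f x" 
    "f (x * y) = f x * f y" "f 0 = 0"
  using assms by (auto simp: algebra_hom_def linear_add linear_diff linear_scale linear_0)

lemma hcm_hom_eqI:
  assumes f: "algebra_hom f" and g: "algebra_hom g"
    and "f cm_Y = g cm_Y" "f cm_X = g cm_X" "f (cm_delta 1) = g (cm_delta 1)"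
  shows "f h = g h"
  by (induction h rule: hcm_induct) (simp_all add: assms algebra_homD[OF f] algebra_homD[OF g] del: One_nat_def)

context cm_rep
begin

definition hcm_lift :: "hcm \<Rightarrow> 'b" where
  "hcm_lift h = free_lift (rep_hcm h)"

lemma hcm_lift_abs: "hcm_lift (abs_hcm x) = free_lift x"
proof -
  have "rep_hcm (abs_hcm x) - x \<in> two_sided_ideal enveloping_relators"
    using Quotient_rep_abs[OF Quotient_hcm, of x] by (simp add: ideal_closed)
  from free_lift_ideal[OF this] show ?thesis
    by (simp add: hcm_lift_def linear_diff[OF linear_free_lift])
qed

lemma linear_hcm_lift: "linear hcm_lift"
proof (rule linearI)
  fix s t and c :: real
  show "hcm_lift (s + t) = hcm_lift s + hcm_lift t"
    by (induct s; induct t)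
       (simp add: plus_hcm.abs_eq hcm_lift_abs linear_add[OF linear_free_lift])
  show "hcm_lift (c *\<^sub>R s) = c *\<^sub>R hcm_lift s"
    by (induct s)
       (simp add: scaleR_hcm.abs_eq hcm_lift_abs linear_scale[OF linear_free_lift])
qed

lemma hcm_lift_one: "hcm_lift 1 = e"
  by (simp add: one_hcm_def hcm_lift_abs free_lift_one)

lemma hcm_lift_mult: "hcm_lift (x * y) = m (hcm_lift x) (hcm_lift y)"
  by (induct x; induct y) (simp add: times_hcm.abs_eq hcm_lift_abs free_lift_mult)

lemma hcm_lift_gens:
  "hcm_lift cm_Y = \<phi> BY" "hcm_lift cm_X = \<phi> BX" "hcm_lift (cm_delta n) = \<phi> (BD (n - 1))"
  by (simp_all add: cm_Y_def cm_X_def cm_delta_def lie_to_hcm.abs_eq hcm_lift_abs free_lift_lie_emb)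

end

lemma cm_rep_case:
  assumes bil: "bilinear m"
    and "\<And>x y z. m (m x y) z = m x (m y z)" "\<And>x. m e x = x" "\<And>x. m x e = x"
    and YX: "m y x - m x y = x"
    and Yd: "\<And>n. m y (d n) - m (d n) y = real (n + 1) *\<^sub>R d n"
    and Xd: "\<And>n. m x (d n) - m (d n) x = d (n + 1)"
    and dd: "\<And>n k. m (d n) (d k) = m (d k) (d n)"
  shows "cm_rep m e (case_cm_basis y x d)"
proof
  have neg: "lin_ext (case_cm_basis y x d) (- z) = - lin_ext (case_cm_basis y x d) z" for z
    by (rule linear_neg[OF linear_lin_ext])
  have zero: "lin_ext (case_cm_basis y x d) 0 = 0"
    by (rule linear_0[OF linear_lin_ext])
  have swap: "p - q = - r" if "q - p = r" for p q r :: 'a using that by (simp add: algebra_simps)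
  show "m (case a of BY \<Rightarrow> y | BX \<Rightarrow> x | BD n \<Rightarrow> d n) (case b of BY \<Rightarrow> y | BX \<Rightarrow> x | BD n \<Rightarrow> d n) -
       m (case b of BY \<Rightarrow> y | BX \<Rightarrow> x | BD n \<Rightarrow> d n) (case a of BY \<Rightarrow> y | BX \<Rightarrow> x | BD n \<Rightarrow> d n) =
       lin_ext (case_cm_basis y x d) (basis_bracket a b)" for a b
    by (cases a; cases b)
       (simp_all only: cm_basis.case basis_bracket.simps neg zero lin_ext_single scaleR_one
          diff_self YX Yd Xd swap[OF YX] swap[OF Yd] swap[OF Xd] dd)
qed (use assms in auto)

lemma bilinear_times: "bilinear ((*) :: 'a::real_algebra \<Rightarrow> 'a \<Rightarrow> 'a)"
  unfolding bilinear_def by (auto intro!: linearI simp: algebra_simps)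

lemma counit_ex1: "\<exists>!\<epsilon>. counit_spec \<epsilon>"
proof (rule ex_ex1I)
  interpret cm_rep "(*) :: real \<Rightarrow> real \<Rightarrow> real" 1 "case_cm_basis 0 0 (\<lambda>_. 0)"
    by (rule cm_rep_case[OF bilinear_times]) auto
  have "counit_spec hcm_lift"
    by (simp add: counit_spec_def algebra_hom_def linear_hcm_lift hcm_lift_one hcm_lift_mult hcm_lift_gens)
  then show "\<exists>\<epsilon>. counit_spec \<epsilon>" by blast
next
  show "\<epsilon> = \<epsilon>'" if "counit_spec \<epsilon>" "counit_spec \<epsilon>'" for \<epsilon> \<epsilon>'
    using that unfolding counit_spec_def by (intro ext) (rule hcm_hom_eqI[of \<epsilon> \<epsilon>']; simp)
qed

lemma counit_spec: "counit_spec counit"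
  unfolding counit_def by (rule theI'[OF counit_ex1])

lemma tensor_induct [case_names zero add]:
  assumes "P 0" "\<And>a b u. P u \<Longrightarrow> P (a \<otimes>\<^sub>t b + u)"
  shows "P t"
proof -
  obtain ps where "t = (\<Sum>(a, b)\<leftarrow>ps. a \<otimes>\<^sub>t b)" using tensor_expand by blast
  moreover have "P (\<Sum>(a, b)\<leftarrow>ps. a \<otimes>\<^sub>t b)" by (induction ps) (auto simp: assms)
  ultimately show ?thesis by simp
qed

subsection \<open>Existence of the coproduct\<close>

lemma hcm1_comm:
  assumes "x \<in> hcm1" "y \<in> hcm1"
  shows "x * y = y * x"
proof -
  have d: "cm_delta n * y = y * cm_delta n" if "y \<in> hcm1" for n y
    using that unfolding hcm1_def
  proof induction
    case (mult x y)
    then show ?case by (metis mult.assoc)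
  qed (auto simp: hcm_relations(4) algebra_simps)
  show ?thesis using assms(1) unfolding hcm1_def
  proof induction
    case (mult u v)
    then show ?case by (metis mult.assoc)
  qed (use d assms(2) in \<open>auto simp: algebra_simps\<close>)
qed

lemma hcm1_closed:
  "1 \<in> hcm1" "n \<ge> 1 \<Longrightarrow> cm_delta n \<in> hcm1" "0 \<in> hcm1"
  "x \<in> hcm1 \<Longrightarrow> y \<in> hcm1 \<Longrightarrow> x + y \<in> hcm1"
  "x \<in> hcm1 \<Longrightarrow> c *\<^sub>R x \<in> hcm1"
  "x \<in> hcm1 \<Longrightarrow> y \<in> hcm1 \<Longrightarrow> x * y \<in> hcm1"
  "x \<in> hcm1 \<Longrightarrow> - x \<in> hcm1"
  "x \<in> hcm1 \<Longrightarrow> y \<in> hcm1 \<Longrightarrow> x - y \<in> hcm1"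
proof -
  show add: "x \<in> hcm1 \<Longrightarrow> y \<in> hcm1 \<Longrightarrow> x + y \<in> hcm1"
    and scale: "x \<in> hcm1 \<Longrightarrow> c *\<^sub>R x \<in> hcm1"
    and "x \<in> hcm1 \<Longrightarrow> y \<in> hcm1 \<Longrightarrow> x * y \<in> hcm1"
    and one: "1 \<in> hcm1" and "n \<ge> 1 \<Longrightarrow> cm_delta n \<in> hcm1" for x y c n
    unfolding hcm1_def by (auto intro: generated_subalgebra.intros)
  show "0 \<in> hcm1" using scale[OF one, of 0] by simp
  show neg: "x \<in> hcm1 \<Longrightarrow> - x \<in> hcm1" for x using scale[of x "-1"] by simp
  show "x \<in> hcm1 \<Longrightarrow> y \<in> hcm1 \<Longrightarrow> x - y \<in> hcm1" using add[OF _ neg, of x y] by simp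
qed

lemma hcm1_derivation:
  assumes gen: "\<And>n. n \<ge> 1 \<Longrightarrow> z * cm_delta n - cm_delta n * z \<in> hcm1" and "x \<in> hcm1"
  shows "z * x - x * z \<in> hcm1"
  using assms(2) unfolding hcm1_def
proof (induction rule: generated_subalgebra.induct)
  case (mult u v)
  have "z * (u * v) - u * v * z = (z * u - u * z) * v + u * (z * v - v * z)"
    by (simp add: algebra_simps)
  with mult show ?case unfolding hcm1_def[symmetric] by (simp add: hcm1_closed)
next
  case (add u v)
  have "z * (u + v) - (u + v) * z = (z * u - u * z) + (z * v - v * z)"
    by (simp add: algebra_simps)
  with add show ?case unfolding hcm1_def[symmetric] by (simp add: hcm1_closed)
next
  case (scale u c)
  have "z * (c *\<^sub>R u) - (c *\<^sub>R u) * z = c *\<^sub>R (z * u - u * z)"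
    by (simp add: algebra_simps)
  with scale show ?case unfolding hcm1_def[symmetric] by (simp add: hcm1_closed)
qed (unfold hcm1_def[symmetric], use gen in \<open>auto simp: hcm1_closed\<close>)

lemma hcm1_adX: "x \<in> hcm1 \<Longrightarrow> cm_X * x - x * cm_X \<in> hcm1"
  by (rule hcm1_derivation) (simp_all add: hcm_relations hcm1_closed del: One_nat_def)

lemma hcm1_adY: "x \<in> hcm1 \<Longrightarrow> cm_Y * x - x * cm_Y \<in> hcm1"
  by (rule hcm1_derivation) (simp_all add: hcm_relations hcm1_closed del: One_nat_def)

definition hcm1_tensor :: "(hcm, hcm) tensor set" where
  "hcm1_tensor = span {a \<otimes>\<^sub>t b | a b. a \<in> hcm1 \<and> b \<in> hcm1}"

lemma tprod_mem_hcm1_tensor: "a \<in> hcm1 \<Longrightarrow> b \<in> hcm1 \<Longrightarrow> a \<otimes>\<^sub>t b \<in> hcm1_tensor"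
  unfolding hcm1_tensor_def by (rule span_base) blast

lemma hcm1_tensor_induct [consumes 1, case_names zero tprod add]:
  assumes "t \<in> hcm1_tensor" and zero: "P 0"
    and tprod: "\<And>a b. a \<in> hcm1 \<Longrightarrow> b \<in> hcm1 \<Longrightarrow> P (a \<otimes>\<^sub>t b)"
    and add: "\<And>x y. P x \<Longrightarrow> P y \<Longrightarrow> P (x + y)"
  shows "P t"
  using assms(1) unfolding hcm1_tensor_def
proof (induction rule: span_induct_alt)
  case (step c x y)
  then obtain a b where "x = a \<otimes>\<^sub>t b" "a \<in> hcm1" "b \<in> hcm1" by blast
  then have "P (c *\<^sub>R x)" using tprod[of "c *\<^sub>R a" b] by (simp add: tprod_scaleR_left hcm1_closed)
  then show ?case using step add by blast
qed (rule zero)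

lemma hcm1_tensor_comm:
  assumes "s \<in> hcm1_tensor" "t \<in> hcm1_tensor"
  shows "s * t = t * s"
  using assms(1)
proof (induction rule: hcm1_tensor_induct)
  case (tprod a b)
  show ?case using assms(2)
    by (induction rule: hcm1_tensor_induct)
       (simp_all add: tprod_mult distrib_left distrib_right hcm1_comm[OF tprod(1)] hcm1_comm[OF tprod(2)])
qed (simp_all add: distrib_left distrib_right)

lemma hcm1_tensor_ad:
  assumes "t \<in> hcm1_tensor" and z: "z = cm_X \<otimes>\<^sub>t 1 + 1 \<otimes>\<^sub>t cm_X + cm_delta 1 \<otimes>\<^sub>t cm_Y"
  shows "z * t - t * z \<in> hcm1_tensor"
  using assms(1)
proof (induction rule: hcm1_tensor_induct)
  case zero
  show ?case by (simp add: hcm1_tensor_def span_zero)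
next
  case (tprod a b)
  note diffs = linear_diff[OF bilinear_tprod[unfolded bilinear_def, THEN conjunct1, rule_format]]
    linear_diff[OF bilinear_tprod[unfolded bilinear_def, THEN conjunct2, rule_format]]
  have "z * (a \<otimes>\<^sub>t b) - (a \<otimes>\<^sub>t b) * z =
      (cm_X * a - a * cm_X) \<otimes>\<^sub>t b + a \<otimes>\<^sub>t (cm_X * b - b * cm_X)
      + (cm_delta 1 * a) \<otimes>\<^sub>t (cm_Y * b - b * cm_Y)"
    using hcm1_comm[OF tprod(1) hcm1_closed(2)[of 1]]
    by (simp add: z diffs distrib_left distrib_right tprod_mult)
  moreover have "\<dots> \<in> hcm1_tensor"
    using tprod unfolding hcm1_tensor_def
    by (intro span_add; fold hcm1_tensor_def)
       (simp_all add: tprod_mem_hcm1_tensor hcm1_adX hcm1_adY hcm1_closed del: One_nat_def)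
  ultimately show ?case by simp
next
  case (add s t)
  have "z * (s + t) - (s + t) * z = (z * s - s * z) + (z * t - t * z)" by (simp add: algebra_simps)
  with add show ?case unfolding hcm1_tensor_def by (simp add: span_add)
qed

primrec iter_ad :: "'a::ring \<Rightarrow> 'a \<Rightarrow> nat \<Rightarrow> 'a" where
  "iter_ad x d 0 = d"
| "iter_ad x d (Suc n) = x * iter_ad x d n - iter_ad x d n * x"

lemma iter_ad_weight:
  fixes x y :: "'a::real_algebra_1"
  assumes yx: "y * x - x * y = x" and "y * d - d * y = d"
  shows "y * iter_ad x d n - iter_ad x d n * y = real (n + 1) *\<^sub>R iter_ad x d n"
proof (induction n)
  case 0
  then show ?case using assms(2) by simp
next
  case (Suc n)
  let ?d = "iter_ad x d n"
  have gen: "(x * ?d - ?d * x) + (x * (c *\<^sub>R ?d) - (c *\<^sub>R ?d) * x) = (1 + c) *\<^sub>R (x * ?d - ?d * x)" for c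
    by (simp add: scaleR_left_distrib scaleR_diff_right)
  have "y * (x * ?d - ?d * x) - (x * ?d - ?d * x) * y =
      ((y * x - x * y) * ?d - ?d * (y * x - x * y)) + (x * (y * ?d - ?d * y) - (y * ?d - ?d * y) * x)"
    by (simp add: algebra_simps)
  also have "\<dots> = real (Suc n + 1) *\<^sub>R (x * ?d - ?d * x)"
    using gen[of "real (n + 1)"] by (simp only: yx Suc.IH) simp
  finally show ?case by simp
qed

lemma coproduct_ex1: "\<exists>!\<Delta>. coproduct_spec \<Delta>"
proof (rule ex_ex1I)
  let ?Y = "cm_Y \<otimes>\<^sub>t 1 + 1 \<otimes>\<^sub>t cm_Y"
  let ?X = "cm_X \<otimes>\<^sub>t 1 + 1 \<otimes>\<^sub>t cm_X + cm_delta 1 \<otimes>\<^sub>t cm_Y"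
  let ?D = "cm_delta 1 \<otimes>\<^sub>t 1 + 1 \<otimes>\<^sub>t cm_delta 1"
  note diffs = linear_diff[OF bilinear_tprod[unfolded bilinear_def, THEN conjunct1, rule_format], symmetric]
    linear_diff[OF bilinear_tprod[unfolded bilinear_def, THEN conjunct2, rule_format], symmetric]
  have Yd1: "cm_Y * cm_delta 1 = cm_delta 1 * cm_Y + cm_delta 1"
    using hcm_relations(2)[of 1] by (simp add: algebra_simps)
  have YX1: "cm_Y * cm_X = cm_X * cm_Y + cm_X"
    using hcm_relations(1) by (simp add: algebra_simps)
  have YX: "?Y * ?X - ?X * ?Y = ?X"
    by (simp add: distrib_left distrib_right tprod_mult Yd1[simplified] YX1 tprod_add_left tprod_add_right)
  have YD: "?Y * ?D - ?D * ?Y = ?D"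
    by (simp add: distrib_left distrib_right tprod_mult Yd1[simplified] tprod_add_left tprod_add_right)
  have mem: "iter_ad ?X ?D n \<in> hcm1_tensor" for n
  proof (induction n)
    case 0
    have "cm_delta 1 \<otimes>\<^sub>t 1 \<in> hcm1_tensor" "1 \<otimes>\<^sub>t cm_delta 1 \<in> hcm1_tensor"
      by (auto intro!: tprod_mem_hcm1_tensor hcm1_closed)
    then show ?case unfolding hcm1_tensor_def by (simp add: span_add)
  next
    case (Suc n)
    show ?case unfolding iter_ad.simps by (rule hcm1_tensor_ad[OF Suc.IH refl])
  qed
  interpret cm_rep "(*)" 1 "case_cm_basis ?Y ?X (iter_ad ?X ?D)"
  proof (rule cm_rep_case[OF bilinear_times _ _ _ YX iter_ad_weight[OF YX YD]])
    show "iter_ad ?X ?D n * iter_ad ?X ?D k = iter_ad ?X ?D k * iter_ad ?X ?D n" for n k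
      by (rule hcm1_tensor_comm[OF mem mem])
  qed (simp_all add: mult.assoc)
  have "coproduct_spec hcm_lift"
    by (simp add: coproduct_spec_def algebra_hom_def linear_hcm_lift hcm_lift_one hcm_lift_mult
        hcm_lift_gens del: One_nat_def)
  then show "\<exists>\<Delta>. coproduct_spec \<Delta>" by blast
next
  show "\<Delta> = \<Delta>'" if "coproduct_spec \<Delta>" "coproduct_spec \<Delta>'" for \<Delta> \<Delta>'
    using that unfolding coproduct_spec_def by (intro ext) (rule hcm_hom_eqI[of \<Delta> \<Delta>']; simp)
qed

lemma coproduct_spec: "coproduct_spec coproduct"
  unfolding coproduct_def by (rule theI'[OF coproduct_ex1])

subsection \<open>Existence of the antipode\<close>

lemma hcm1_coproduct:
  assumes "h \<in> hcm1"
  shows "coproduct h \<in> hcm1_tensor"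
proof -
  note hom = algebra_homD[of coproduct]
  have cp: "algebra_hom coproduct"
      "coproduct cm_X = cm_X \<otimes>\<^sub>t 1 + 1 \<otimes>\<^sub>t cm_X + cm_delta 1 \<otimes>\<^sub>t cm_Y"
      "coproduct (cm_delta 1) = cm_delta 1 \<otimes>\<^sub>t 1 + 1 \<otimes>\<^sub>t cm_delta 1"
    using coproduct_spec by (auto simp: coproduct_spec_def)
  have add: "s + t \<in> hcm1_tensor" if "s \<in> hcm1_tensor" "t \<in> hcm1_tensor" for s t
    using that unfolding hcm1_tensor_def by (rule span_add)
  have zero: "0 \<in> hcm1_tensor"
    unfolding hcm1_tensor_def by (rule span_zero)
  have scale: "c *\<^sub>R t \<in> hcm1_tensor" if "t \<in> hcm1_tensor" for c t
    using that unfolding hcm1_tensor_def by (rule span_scale)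
  have mult: "s * t \<in> hcm1_tensor" if "s \<in> hcm1_tensor" and t: "t \<in> hcm1_tensor" for s t
    using that(1)
  proof (induction rule: hcm1_tensor_induct)
    case (tprod a b)
    show ?case using t
      by (induction rule: hcm1_tensor_induct)
         (simp_all add: distrib_left add zero tprod_mult tprod_mem_hcm1_tensor hcm1_closed tprod)
  qed (simp_all add: distrib_right add zero)
  have delta: "coproduct (cm_delta (Suc n)) \<in> hcm1_tensor" for n
  proof (induction n)
    case 0
    show ?case using cp(3) add tprod_mem_hcm1_tensor hcm1_closed by simp
  next
    case (Suc n)
    have "coproduct (cm_delta (Suc n + 1)) = coproduct cm_X * coproduct (cm_delta (Suc n)) -
        coproduct (cm_delta (Suc n)) * coproduct cm_X"
      using hcm_relations(3)[of "Suc n"] hom(3,5)[OF cp(1)] by (metis le_add1 plus_1_eq_Suc)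
    with hcm1_tensor_ad[OF Suc.IH cp(2)] show ?case by simp
  qed
  show ?thesis using assms unfolding hcm1_def
  proof induction
    case one
    have "1 \<otimes>\<^sub>t 1 \<in> hcm1_tensor" by (intro tprod_mem_hcm1_tensor hcm1_closed)
    then show ?case by (simp add: hom(1)[OF cp(1)] tprod_one)
  next
    case (gen g)
    then obtain n where "n \<ge> 1" "g = cm_delta n" by blast
    then show ?case using delta[of "n - 1"] by simp
  qed (simp_all add: hom(2,4,5)[OF cp(1)] add scale mult)
qed

lemma hcm1_tensor_sum_list:
  assumes "t \<in> hcm1_tensor"
  shows "\<exists>ps. set ps \<subseteq> hcm1 \<times> hcm1 \<and> t = (\<Sum>(a, b)\<leftarrow>ps. a \<otimes>\<^sub>t b)"
  using assms
proof (induction rule: hcm1_tensor_induct)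
  case zero
  show ?case by (rule exI[of _ "[]"]) simp
next
  case (tprod a b)
  then show ?case by (intro exI[of _ "[(a, b)]"]) simp
next
  case (add x y)
  then obtain ps qs where "set ps \<subseteq> hcm1 \<times> hcm1" "x = (\<Sum>(a, b)\<leftarrow>ps. a \<otimes>\<^sub>t b)"
    "set qs \<subseteq> hcm1 \<times> hcm1" "y = (\<Sum>(a, b)\<leftarrow>qs. a \<otimes>\<^sub>t b)" by blast
  then show ?case by (intro exI[of _ "ps @ qs"]) simp
qed

theorem antipode_exists: "\<exists>S. antipode_on hcm1 coproduct counit S"
proof -
  define SX where SX: "SX = - cm_X + cm_delta 1 * cm_Y"
  define s where "s = iter_ad (- SX) (- cm_delta 1)"
  have s_simps: "s 0 = - cm_delta 1" "s (Suc n) = s n * SX - SX * s n" for n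
    by (simp_all add: s_def algebra_simps)
  have YX: "cm_Y * cm_X = cm_X * cm_Y + cm_X"
    using hcm_relations(1) by (simp add: algebra_simps)
  have Yd: "cm_Y * cm_delta 1 = cm_delta 1 * cm_Y + cm_delta 1"
    using hcm_relations(2)[of 1] by (simp add: algebra_simps)
  have Yd': "cm_Y * (cm_delta 1 * z) = cm_delta 1 * (cm_Y * z) + cm_delta 1 * z" for z
    using arg_cong[OF Yd, of "\<lambda>x. x * z"] by (simp add: algebra_simps)
  have YSX: "cm_Y * - SX - - SX * cm_Y = - SX"
    using YX Yd' by (simp add: SX algebra_simps)
  have sY: "cm_Y * s n - s n * cm_Y = real (n + 1) *\<^sub>R s n" for n
    unfolding s_def using YSX Yd by (intro iter_ad_weight) (simp_all add: algebra_simps)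
  have s_mem: "s n \<in> hcm1" for n
  proof (induction n)
    case (Suc n)
    have "s (Suc n) = (cm_X * s n - s n * cm_X) - cm_delta 1 * (cm_Y * s n - s n * cm_Y)"
      using hcm1_comm[OF Suc.IH hcm1_closed(2)[of 1]]
      by (simp add: s_simps SX algebra_simps) (simp flip: mult.assoc)
    then show ?case using Suc by (simp add: hcm1_closed hcm1_adX hcm1_adY del: One_nat_def)
  qed (simp add: s_simps hcm1_closed del: One_nat_def)
  interpret cm_rep "\<lambda>x y. y * x" 1 "case_cm_basis (- cm_Y) SX s"
  proof (rule cm_rep_case)
    show "bilinear (\<lambda>x y :: hcm. y * x)"
      unfolding bilinear_def by (auto intro!: linearI simp: algebra_simps)
    show "SX * - cm_Y - - cm_Y * SX = SX" using YSX by (simp add: algebra_simps)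
    show "s n * - cm_Y - - cm_Y * s n = real (n + 1) *\<^sub>R s n" for n
      using sY[of n] by (simp add: algebra_simps)
    show "s n * SX - SX * s n = s (n + 1)" for n by (simp add: s_simps)
    show "s k * s n = s n * s k" for n k by (rule hcm1_comm[OF s_mem s_mem])
  qed (simp_all add: mult.assoc)
  define S where "S = hcm_lift"
  note linS = linear_hcm_lift[folded S_def] and S_one = hcm_lift_one[folded S_def]
    and S_mult = hcm_lift_mult[folded S_def] and S_gens = hcm_lift_gens[folded S_def, simplified cm_basis.case]
  have cp: "algebra_hom coproduct" 
      "coproduct cm_Y = cm_Y \<otimes>\<^sub>t 1 + 1 \<otimes>\<^sub>t cm_Y"
      "coproduct cm_X = cm_X \<otimes>\<^sub>t 1 + 1 \<otimes>\<^sub>t cm_X + cm_delta 1 \<otimes>\<^sub>t cm_Y"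
      "coproduct (cm_delta 1) = cm_delta 1 \<otimes>\<^sub>t 1 + 1 \<otimes>\<^sub>t cm_delta 1"
    using coproduct_spec by (auto simp: coproduct_spec_def)
  have cu: "algebra_hom counit" "counit cm_Y = 0" "counit cm_X = 0" "counit (cm_delta 1) = 0"
    using counit_spec by (auto simp: counit_spec_def)
  have bl: "bilinear (\<lambda>a b. S a * b)" and br: "bilinear (\<lambda>a b. a * S b)"
    unfolding bilinear_def
    by (auto intro!: linearI simp: linear_add[OF linS] linear_scale[OF linS] algebra_simps)
  let ?L = "tensor_lift (\<lambda>a b. S a * b)" and ?R = "tensor_lift (\<lambda>a b. a * S b)"
  note L = linear_tensor_lift[OF bl] tensor_lift_tprod[OF bl]
  note R = linear_tensor_lift[OF br] tensor_lift_tprod[OF br]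
  have Lp: "?L (u * (a \<otimes>\<^sub>t b)) = S a * ?L u * b" for u a b
    by (induction u rule: tensor_induct)
       (simp_all add: linear_0[OF L(1)] linear_add[OF L(1)] L(2) distrib_left distrib_right tprod_mult
          S_mult mult.assoc)
  have Rp: "?R ((a \<otimes>\<^sub>t b) * u) = a * ?R u * S b" for u a b
    by (induction u rule: tensor_induct)
       (simp_all add: linear_0[OF R(1)] linear_add[OF R(1)] R(2) distrib_left distrib_right tprod_mult
          S_mult mult.assoc)
  have Lm: "?L (u * v) = c *\<^sub>R ?L v" if "?L u = c *\<^sub>R 1" for u v c
    by (induction v rule: tensor_induct)
       (simp_all add: Lp that linear_0[OF L(1)] linear_add[OF L(1)] L(2) distrib_left scaleR_add_right)
  have Rm: "?R (u * v) = c *\<^sub>R ?R u" if "?R v = c *\<^sub>R 1" for u v c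
    by (induction u rule: tensor_induct)
       (simp_all add: Rp that linear_0[OF R(1)] linear_add[OF R(1)] R(2) distrib_right scaleR_add_right)
  note simps = algebra_homD[OF cp(1)] algebra_homD[OF cu(1)] cp(2-) cu(2-) S_gens S_one
  have Lh: "?L (coproduct h) = counit h *\<^sub>R 1" for h
  proof (induction h rule: hcm_induct)
    case one
    then show ?case using L(2)[of 1 1] by (simp add: simps tprod_one)
  qed (simp_all add: simps Lm linear_add[OF L(1)] linear_scale[OF L(1)] L(2) s_simps SX algebra_simps del: One_nat_def)
  have Rh: "?R (coproduct h) = counit h *\<^sub>R 1" for h
  proof (induction h rule: hcm_induct)
    case one
    then show ?case using R(2)[of 1 1] by (simp add: simps tprod_one)
  qed (simp_all add: simps Rm linear_add[OF R(1)] linear_scale[OF R(1)] R(2) s_simps SX algebra_simps del: One_nat_def)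
  have L_sum: "?L (\<Sum>(a, b)\<leftarrow>ps. a \<otimes>\<^sub>t b) = (\<Sum>(a, b)\<leftarrow>ps. S a * b)" for ps
    by (induction ps) (auto simp: linear_0[OF L(1)] linear_add[OF L(1)] L(2))
  have R_sum: "?R (\<Sum>(a, b)\<leftarrow>ps. a \<otimes>\<^sub>t b) = (\<Sum>(a, b)\<leftarrow>ps. a * S b)" for ps
    by (induction ps) (auto simp: linear_0[OF R(1)] linear_add[OF R(1)] R(2))
  have "S x \<in> hcm1" if "x \<in> hcm1" for x
    using that unfolding hcm1_def
  proof (induction rule: generated_subalgebra.induct)
    case (gen g)
    then show ?case using s_mem by (auto simp: S_gens hcm1_def)
  next
    case (mult x y)
    then show ?case by (simp add: S_mult generated_subalgebra.mult)
  qed (auto simp: S_one linear_add[OF linS] linear_scale[OF linS]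
      intro: generated_subalgebra.intros)
  moreover have "(\<Sum>(a, b)\<leftarrow>ps. S a * b) = counit h *\<^sub>R 1 \<and> (\<Sum>(a, b)\<leftarrow>ps. a * S b) = counit h *\<^sub>R 1"
    if "coproduct h = (\<Sum>(a, b)\<leftarrow>ps. a \<otimes>\<^sub>t b)" for h ps
    using Lh[of h] Rh[of h] unfolding that L_sum R_sum by simp
  ultimately have "antipode_on hcm1 coproduct counit S"
    unfolding antipode_on_def
    by (auto simp: linear_add[OF linS] linear_scale[OF linS])
  then show ?thesis by blast
qed

lemma counit_left: "tensor_lift (\<lambda>a b. counit a *\<^sub>R b) (coproduct h) = h"
  and counit_right: "tensor_lift (\<lambda>a b. counit b *\<^sub>R a) (coproduct h) = h"
proof -
  have cp: "algebra_hom coproduct"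
      "coproduct cm_Y = cm_Y \<otimes>\<^sub>t 1 + 1 \<otimes>\<^sub>t cm_Y"
      "coproduct cm_X = cm_X \<otimes>\<^sub>t 1 + 1 \<otimes>\<^sub>t cm_X + cm_delta 1 \<otimes>\<^sub>t cm_Y"
      "coproduct (cm_delta 1) = cm_delta 1 \<otimes>\<^sub>t 1 + 1 \<otimes>\<^sub>t cm_delta 1"
    using coproduct_spec by (auto simp: coproduct_spec_def)
  have cu: "algebra_hom counit" "counit cm_Y = 0" "counit cm_X = 0" "counit (cm_delta 1) = 0"
    using counit_spec by (auto simp: counit_spec_def)
  let ?l = "\<lambda>a b :: hcm. counit a *\<^sub>R b" and ?r = "\<lambda>a b. counit b *\<^sub>R (a :: hcm)"
  have hom: "tensor_lift \<beta> (coproduct h) = h"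
    if b: "bilinear \<beta>" and mult: "\<And>a b c d. \<beta> (a * c) (b * d) = \<beta> a b * \<beta> c d"
      and \<beta>: "\<beta> 1 1 = 1" "\<beta> cm_Y 1 + \<beta> 1 cm_Y = cm_Y" "\<beta> cm_X 1 + \<beta> 1 cm_X + \<beta> (cm_delta 1) cm_Y = cm_X"
        "\<beta> (cm_delta 1) 1 + \<beta> 1 (cm_delta 1) = cm_delta 1" for \<beta>
  proof -
    note L = linear_tensor_lift[OF b] tensor_lift_tprod[OF b]
    have "tensor_lift \<beta> ((c \<otimes>\<^sub>t d) * v) = tensor_lift \<beta> (c \<otimes>\<^sub>t d) * tensor_lift \<beta> v" for c d v
      by (induction v rule: tensor_induct)
         (simp_all add: linear_0[OF L(1)] linear_add[OF L(1)] L(2) tprod_mult mult distrib_left)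
    then have m: "tensor_lift \<beta> (u * v) = tensor_lift \<beta> u * tensor_lift \<beta> v" for u v
      by (induction u rule: tensor_induct)
         (simp_all add: linear_0[OF L(1)] linear_add[OF L(1)] distrib_right)
    show ?thesis
    proof (induction h rule: hcm_induct)
      case one
      show ?case using L(2)[of 1 1] \<beta>(1) by (simp add: algebra_homD[OF cp(1)] tprod_one)
    qed (simp_all add: algebra_homD[OF cp(1)] cp(2-) linear_add[OF L(1)] linear_scale[OF L(1)] L(2) m \<beta>
        del: One_nat_def)
  qed
  have bl: "bilinear ?l" and br: "bilinear ?r"
    unfolding bilinear_def by (auto intro!: linearI simp: algebra_homD[OF cu(1)] algebra_simps)
  show "tensor_lift ?l (coproduct h) = h"
    by (rule hom[OF bl]) (simp_all add: algebra_homD[OF cu(1)] cu(2-) del: One_nat_def)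
  show "tensor_lift ?r (coproduct h) = h"
    by (rule hom[OF br]) (simp_all add: algebra_homD[OF cu(1)] cu(2-) del: One_nat_def)
qed


section \<open>Coefficients\<close>

definition splittings :: "nat \<Rightarrow> nat list \<Rightarrow> nat list list set" where
  "splittings t ns = {nss. length nss = t \<and> [] \<notin> set nss \<and> concat nss = ns}"

definition coef_A :: "nat list list \<Rightarrow> real" where
  "coef_A nss = 1 / (\<Prod>ns\<leftarrow>nss. fact (length ns)) * (\<Prod>ns\<leftarrow>nss. 1 / (real (sum_list ns) + 1))"

definition coef_B :: "nat \<Rightarrow> nat list list \<Rightarrow> real" where
  "coef_B k nss = real (k choose length (last nss)) *
     (\<Prod>i<length nss - 1. real ((sum_list (map sum_list (drop (Suc i) nss)) + k) choose length (nss ! i)))"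

definition coef_U :: "nat list \<Rightarrow> nat \<Rightarrow> real" where
  "coef_U ms k = (\<Sum>i = 1..length ms. (-1) ^ (i - 1) * (\<Sum>mss\<in>splittings i ms. coef_B k mss))"

definition cm_beta :: "nat list \<Rightarrow> real" where
  "cm_beta ns = (if length ns = 1 then - 1 else
     (\<Sum>t = 1..length ns - 1. \<Sum>nss\<in>splittings t (butlast ns).
        coef_U (map sum_list nss) (last ns) * coef_A nss))"

lemma finite_splittings: "finite (splittings t ns)"
proof (rule finite_subset)
  show "splittings t ns \<subseteq> {nss. set nss \<subseteq> {xs. set xs \<subseteq> set ns \<and> length xs \<le> length ns} \<and> length nss = t}"
    by (auto simp: splittings_def length_concat intro!: member_le_sum_list)
  show "finite \<dots>" by (intro finite_lists_length_eq finite_lists_length_le) simp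
qed

lemma finite_compositions: "finite {ns :: nat list. ns \<noteq> [] \<and> (\<forall>k\<in>set ns. k \<ge> 1) \<and> sum_list ns = n}"
proof (rule finite_subset)
  have "length ns \<le> sum_list ns" if "\<forall>k\<in>set ns. k \<ge> 1" for ns :: "nat list"
    using that by (induction ns) auto
  then show "{ns. ns \<noteq> [] \<and> (\<forall>k\<in>set ns. k \<ge> 1) \<and> sum_list ns = n}
      \<subseteq> {ns. set ns \<subseteq> {..n} \<and> length ns \<le> n}"
    by (auto intro: member_le_sum_list)
  show "finite {ns. set ns \<subseteq> {..n} \<and> length ns \<le> n}" by (intro finite_lists_length_le) simp
qed

end

theory Submission
  imports Defs "HOL-Computational_Algebra.Formal_Power_Series"
begin

text \<open>
  Put \<open>a\<^sub>k = \<delta>\<^sub>k / k!\<close> and let \<open>\<phi>(x)\<close> be the primitive of \<open>exp (\<Sum> a\<^sub>k x\<^sup>k)\<close> vanishing at \<open>0\<close>, so that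
  \<open>\<phi>(x) = x (1 + \<Sum> c\<^sub>m x\<^sup>m)\<close> where \<open>c\<^sub>m\<close> is the sum of the \<open>A(n) a\<^sub>n\<close> over the sequences \<open>n\<close> of weight \<open>m\<close>.
  The matrix \<open>M\<close> of composition with \<open>\<phi>\<close>, whose \<open>n\<close>-th column is \<open>\<phi>\<^sup>n\<close>, is unitriangular, and
  expanding \<open>M\<^sup>-\<^sup>1\<close> as a geometric series produces the alternating sums \<open>U\<close>. The claim thus says
  that the vector \<open>r\<^sub>n = S(\<delta>\<^sub>n) / n!\<close> satisfies \<open>M r = - a\<close>.

  On the Hopf side, applying the antipode axiom to \<open>[X, h]\<close> and cancelling on the left by
  coassociativity gives \<open>S(\<delta>\<^sub>n\<^sub>+\<^sub>1) = [X, S(\<delta>\<^sub>n)] - n \<delta>\<^sub>1 S(\<delta>\<^sub>n)\<close>. The solution of \<open>M r = - a\<close> obeys the same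
  recursion, because the derivation \<open>[X, -] - d/dx\<close> maps \<open>\<phi>\<close> to \<open>- 1 - \<delta>\<^sub>1 \<phi>\<close>.
\<close>

unbundle fps_syntax

section \<open>Sums over compositions and their blockings\<close>

definition compositions :: "nat \<Rightarrow> nat list set" where
  "compositions n = {ns. (\<forall>k\<in>set ns. k \<ge> 1) \<and> sum_list ns = n}"

lemma finite_compositions_of [simp]: "finite (compositions n)"
  by (rule finite_subset[OF _ finite.insertI[OF finite_compositions[of n], of "[]"]])
     (auto simp: compositions_def)

lemma compositions_0 [simp]: "compositions 0 = {[]}"
proof -
  have "ns = []" if "\<forall>k\<in>set ns. k \<ge> 1" "sum_list ns = 0" for ns :: "nat list"
    using that by (cases ns) auto
  then show ?thesis by (auto simp: compositions_def)
qed

lemma sum_list_compositions: "ns \<in> compositions n \<Longrightarrow> sum_list ns = n"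
  by (simp add: compositions_def)

lemma sum_compositions_Nil:
  "(\<Sum>w\<in>compositions n. if w = [] then f w else 0) = (if n = 0 then f [] else 0)"
proof -
  have "[] \<in> compositions n \<longleftrightarrow> n = 0" by (auto simp: compositions_def)
  then show ?thesis by simp
qed

lemma sum_compositions_Cons:
  assumes "n > 0"
  shows "(\<Sum>w\<in>compositions n. f w) = (\<Sum>k=1..n. \<Sum>w\<in>compositions (n - k). f (k # w))"
proof -
  have "(\<Sum>k=1..n. \<Sum>w\<in>compositions (n - k). f (k # w)) =
      (\<Sum>(k, w)\<in>(SIGMA k:{1..n}. compositions (n - k)). f (k # w))"
    by (rule sum.Sigma) auto
  also have "\<dots> = (\<Sum>w\<in>compositions n. f w)"
  proof (rule sum.reindex_bij_witness[where i = "\<lambda>w. (hd w, tl w)" and j = "\<lambda>(k, w). k # w"], goal_cases)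
    case (4 w)
    with assms obtain k v where "w = k # v" by (cases w) (auto simp: compositions_def)
    with 4 show ?case by (auto simp: compositions_def)
  next
    case (3 w)
    with assms show ?case by (cases w) (auto simp: compositions_def)
  qed (auto simp: compositions_def)
  finally show ?thesis by simp
qed

text \<open>\<open>cm_beta\<close> treats the last entry of its argument separately, so words must
  also be split at the end; reversal reduces this to \<open>sum_compositions_Cons\<close>.\<close>

lemma sum_compositions_snoc:
  assumes "n > 0"
  shows "(\<Sum>w\<in>compositions n. f w) = (\<Sum>k=1..n. \<Sum>w\<in>compositions (n - k). f (w @ [k]))"
proof -
  have rev: "(\<Sum>w\<in>compositions m. g (rev w)) = (\<Sum>w\<in>compositions m. g w)" for g :: "nat list \<Rightarrow> 'a" and m
    by (rule sum.reindex_bij_witness[where i = rev and j = rev]) (auto simp: compositions_def)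
  show ?thesis
    using sum_compositions_Cons[OF assms, of "\<lambda>w. f (rev w)"]
    by (simp only: rev rev.simps rev[of "\<lambda>w. f (w @ _)"])
qed

text \<open>A word with a cut position is a pair (tail, head), sorted by the weight \<open>m\<close>
  of the tail. Read from right to left, this turns a product of matrices indexed by weights into a
  sum over words.\<close>

lemma sum_compositions_append:
  "(\<Sum>ms\<in>compositions n. \<Sum>i\<le>length ms. f (take i ms) (drop i ms)) =
   (\<Sum>m\<le>n. \<Sum>q\<in>compositions m. \<Sum>p\<in>compositions (n - m). f p q)"
proof -
  have "(\<Sum>ms\<in>compositions n. \<Sum>i\<le>length ms. f (take i ms) (drop i ms)) =
      (\<Sum>(ms, i)\<in>(SIGMA ms:compositions n. {..length ms}). f (take i ms) (drop i ms))"
    by (rule sum.Sigma) auto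
  also have "\<dots> = (\<Sum>(m, q, p)\<in>(SIGMA m:{..n}. compositions m \<times> compositions (n - m)). f p q)"
  proof (rule sum.reindex_bij_witness[where
      i = "\<lambda>(m, q, p). (p @ q, length p)" and
      j = "\<lambda>(ms, i). (sum_list (drop i ms), drop i ms, take i ms)"], goal_cases)
    case (2 x)
    then obtain ms i where x: "x = (ms, i)" "ms \<in> compositions n" by (cases x) auto
    have "sum_list (take i ms) + sum_list (drop i ms) = sum_list ms"
      by (metis append_take_drop_id sum_list_append)
    with x show ?case by (auto simp: compositions_def dest: in_set_takeD in_set_dropD)
  qed (auto simp: compositions_def)
  also have "\<dots> = (\<Sum>m\<le>n. \<Sum>q\<in>compositions m. \<Sum>p\<in>compositions (n - m). f p q)"
    by (simp add: sum.cartesian_product sum.Sigma)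
  finally show ?thesis .
qed

section \<open>Blockings: splittings with any number of blocks\<close>

definition blockings :: "'a list \<Rightarrow> 'a list list set" where
  "blockings xs = {xss. [] \<notin> set xss \<and> concat xss = xs}"

lemma length_blocking:
  assumes "xss \<in> blockings xs"
  shows "length xss \<le> length xs"
proof -
  have "[] \<notin> set xss \<Longrightarrow> length xss \<le> length (concat xss)"
  proof (induction xss)
    case (Cons xs xss)
    then show ?case by (cases xs) auto
  qed simp
  with assms show ?thesis by (simp add: blockings_def)
qed

lemma Nil_in_blockings_iff: "xss \<in> blockings xs \<Longrightarrow> xss = [] \<longleftrightarrow> xs = []"
  using length_blocking[of xss xs] by (auto simp: blockings_def)

lemma blockings_Nil [simp]: "blockings [] = {[]}"
proof (intro equalityI subsetI)
  show "xss \<in> {[]}" if "xss \<in> blockings []" for xss :: "'a list list"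
    using Nil_in_blockings_iff[OF that] by simp
qed (simp add: blockings_def)

lemma splittings_eq: "splittings t xs = {xss \<in> blockings xs. length xss = t}"
  by (auto simp: splittings_def blockings_def)

lemma finite_blockings [simp]: "finite (blockings xs)" for xs :: "nat list"
proof (rule finite_subset)
  show "blockings xs \<subseteq> (\<Union>t\<le>length xs. splittings t xs)"
    by (auto simp: splittings_eq length_blocking)
qed (simp add: finite_splittings)

text \<open>A blocking of a nonempty word has between 1 and \<open>length xs\<close> blocks, so the
  number of blocks can be forgotten. This removes the outer sums from \<open>cm_beta\<close> and
  \<open>coef_U\<close>.\<close>

lemma sum_splittings:
  fixes xs :: "nat list"
  shows "xs \<noteq> [] \<Longrightarrow> (\<Sum>t = 1..length xs. \<Sum>xss\<in>splittings t xs. f xss) = (\<Sum>xss\<in>blockings xs. f xss)"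
proof -
  assume xs: "xs \<noteq> []"
  have "length ` blockings xs \<subseteq> {1..length xs}"
  proof (rule image_subsetI)
    fix xss assume *: "xss \<in> blockings xs"
    then have "xss \<noteq> []" using xs Nil_in_blockings_iff by blast
    with length_blocking[OF *] show "length xss \<in> {1..length xs}" by (simp add: Suc_le_eq)
  qed
  then show ?thesis by (simp only: splittings_eq sum.group finite_blockings finite_atLeastAtMost)
qed

lemma sum_blockings_Cons:
  fixes xs :: "nat list"
  assumes "xs \<noteq> []"
  shows "(\<Sum>xss\<in>blockings xs. f xss) =
    (\<Sum>i=1..length xs. \<Sum>xss\<in>blockings (drop i xs). f (take i xs # xss))"
proof -
  have "(\<Sum>i=1..length xs. \<Sum>xss\<in>blockings (drop i xs). f (take i xs # xss)) =
      (\<Sum>(i, xss)\<in>(SIGMA i:{1..length xs}. blockings (drop i xs)). f (take i xs # xss))"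
    by (rule sum.Sigma) auto
  also have "\<dots> = (\<Sum>xss\<in>blockings xs. f xss)"
  proof (rule sum.reindex_bij_witness[where
      i = "\<lambda>xss. (length (hd xss), tl xss)" and j = "\<lambda>(i, xss). take i xs # xss"], goal_cases)
    case (3 xss)
    with assms show ?case by (cases xss) (auto simp: blockings_def)
  next
    case (4 xss)
    with assms obtain ys yss where "xss = ys # yss" by (cases xss) (auto simp: blockings_def)
    with 4 show ?case by (auto simp: blockings_def Suc_le_eq)
  qed (auto simp: blockings_def)
  finally show ?thesis by simp
qed

lemma sum_list_concat: "sum_list (concat xss) = sum_list (map sum_list xss)"
  by (induction xss) auto

text \<open>For prescribed weights \<open>ms\<close> the blocks vary independently, so sums of
  multiplicative terms over this set factor.\<close>

definition block_lists :: "nat list \<Rightarrow> nat list list set" where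
  "block_lists ms = {nss. list_all2 (\<lambda>ns m. ns \<in> compositions m) nss ms}"

lemma block_lists_Nil [simp]: "block_lists [] = {[]}"
  by (auto simp: block_lists_def)

lemma sum_block_lists_Cons:
  "(\<Sum>nss\<in>block_lists (m # ms). f nss) = (\<Sum>ns\<in>compositions m. \<Sum>nss\<in>block_lists ms. f (ns # nss))"
proof -
  have "(\<Sum>ns\<in>compositions m. \<Sum>nss\<in>block_lists ms. f (ns # nss)) =
      (\<Sum>(ns, nss)\<in>compositions m \<times> block_lists ms. f (ns # nss))"
    by (rule sum.cartesian_product)
  also have "\<dots> = (\<Sum>nss\<in>block_lists (m # ms). f nss)"
    by (rule sum.reindex_bij_witness[where i = "\<lambda>nss. (hd nss, tl nss)" and j = "\<lambda>(ns, nss). ns # nss"])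
       (auto simp: block_lists_def list_all2_Cons2)
  finally show ?thesis by simp
qed

text \<open>Both sides run over the lists of nonempty blocks of total weight \<open>n\<close>,
  sorted on the left by their concatenation and on the right by their weights.\<close>

lemma sum_blockings_compositions:
  "(\<Sum>w\<in>compositions n. \<Sum>nss\<in>blockings w. f nss) = (\<Sum>ms\<in>compositions n. \<Sum>nss\<in>block_lists ms. f nss)"
proof -
  let ?B = "{nss. [] \<notin> set nss \<and> concat nss \<in> compositions n}"
  have B: "?B = (\<Union>w\<in>compositions n. blockings w)" by (auto simp: blockings_def)
  then have fin: "finite ?B" by simp
  have cat: "blockings w = {nss\<in>?B. concat nss = w}" if "w \<in> compositions n" for w
    using that by (auto simp: blockings_def)
  have sums: "map sum_list nss \<in> compositions n" if "nss \<in> ?B" for nss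
  proof -
    have "sum_list ns \<ge> 1" if "ns \<in> set nss" for ns
    proof -
      have "ns \<noteq> []" using \<open>nss \<in> ?B\<close> that by blast
      then obtain k ks where ns: "ns = k # ks" by (cases ns) auto
      then have "k \<ge> 1" using \<open>nss \<in> ?B\<close> that by (auto simp: compositions_def)
      then show ?thesis by (simp add: ns)
    qed
    with that show ?thesis by (auto simp: compositions_def sum_list_concat)
  qed
  have bl: "block_lists ms = {nss\<in>?B. map sum_list nss = ms}" if "ms \<in> compositions n" for ms
  proof (intro equalityI subsetI)
    fix nss assume "nss \<in> block_lists ms"
    then have l: "length nss = length ms" and nss: "\<And>i. i < length ms \<Longrightarrow> nss ! i \<in> compositions (ms ! i)"
      by (auto simp: block_lists_def list_all2_conv_all_nth)
    then have ms: "map sum_list nss = ms" 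
      by (auto simp: list_eq_iff_nth_eq compositions_def)
    have "\<forall>k\<in>set ns. k \<ge> 1" "ns \<noteq> []" if ns: "ns \<in> set nss" for ns
    proof -
      obtain i where i: "i < length ms" "ns = nss ! i" using ns l by (metis in_set_conv_nth)
      then have "ms ! i \<ge> 1" using \<open>ms \<in> compositions n\<close> by (auto simp: compositions_def)
      then show "\<forall>k\<in>set ns. k \<ge> 1" "ns \<noteq> []" using nss[OF i(1)] i(2) by (auto simp: compositions_def)
    qed
    moreover have "sum_list (concat nss) = n" using ms that by (simp add: sum_list_concat compositions_def)
    ultimately show "nss \<in> {nss\<in>?B. map sum_list nss = ms}" using ms by (simp add: compositions_def) blast
  next
    fix nss assume "nss \<in> {nss\<in>?B. map sum_list nss = ms}"
    then show "nss \<in> block_lists ms"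
      by (auto simp: block_lists_def list_all2_conv_all_nth compositions_def)
  qed
  have "(\<Sum>w\<in>compositions n. \<Sum>nss\<in>blockings w. f nss) = (\<Sum>nss\<in>?B. f nss)"
  proof -
    have "concat ` ?B \<subseteq> compositions n" by blast
    from sum.group[OF fin _ this, where h = f] show ?thesis by (simp add: cat)
  qed
  also have "\<dots> = (\<Sum>ms\<in>compositions n. \<Sum>nss\<in>block_lists ms. f nss)"
  proof -
    have "map sum_list ` ?B \<subseteq> compositions n" using sums by blast
    from sum.group[OF fin _ this, where h = f] show ?thesis by (simp add: bl)
  qed
  finally show ?thesis .
qed

text \<open>
  The coefficient of \<open>c\<^bsub>ms\<^esub> x\<^bsup>|ms| + k\<^esup>\<close> in the \<open>k\<close>-th power of the inverse series. The case \<open>mss = []\<close> is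
  split off because \<^const>\<open>coef_B\<close> takes the last block.
\<close>

definition inv_coef :: "nat list \<Rightarrow> nat \<Rightarrow> real" where
  "inv_coef ms k = (\<Sum>mss\<in>blockings ms. (-1) ^ length mss * (if mss = [] then 1 else coef_B k mss))"

lemma inv_coef_Nil [simp]: "inv_coef [] k = 1"
  by (simp add: inv_coef_def)

text \<open>The binomial of a block involves only the total weight behind it, so a new first block
  contributes one factor. With nothing behind it, this is the last-block factor of
  \<open>coef_B\<close>.\<close>

lemma coef_B_Cons:
  "coef_B k (ms # mss) = real ((sum_list (concat mss) + k) choose length ms) * (if mss = [] then 1 else coef_B k mss)"
proof (cases mss)
  case (Cons ns nss)
  have "(\<Prod>i<length mss. real ((sum_list (map sum_list (drop i mss)) + k) choose length ((ms # mss) ! i))) =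
    real ((sum_list (map sum_list mss) + k) choose length ms) * 
    (\<Prod>i<length mss - 1. real ((sum_list (map sum_list (drop (Suc i) mss)) + k) choose length (mss ! i)))"
    unfolding Cons by (simp add: prod.lessThan_Suc_shift del: prod.lessThan_Suc)
  with Cons show ?thesis by (simp add: coef_B_def sum_list_concat)
qed (simp add: coef_B_def)

text \<open>Peeling off a first block of length \<open>i\<close> gives \<open>inv_coef ms k\<close>
  as minus the sum of the terms with \<open>i \<ge> 1\<close>, and it is itself the term
  \<open>i = 0\<close>. This is the cancellation behind
  \<open>M M\<^sup>-\<^sup>1 = 1\<close>.\<close>

lemma inv_coef_rec:
  assumes "ms \<noteq> []"
  shows "(\<Sum>i\<le>length ms. real ((sum_list (drop i ms) + k) choose i) * inv_coef (drop i ms) k) = 0"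
proof -
  have "inv_coef ms k = (\<Sum>i=1..length ms. \<Sum>mss\<in>blockings (drop i ms). (-1) ^ Suc (length mss) * coef_B k (take i ms # mss))"
    unfolding inv_coef_def sum_blockings_Cons[OF assms] by simp
  also have "\<dots> = (\<Sum>i=1..length ms. - (real ((sum_list (drop i ms) + k) choose i) * inv_coef (drop i ms) k))"
    by (intro sum.cong refl) (auto simp: coef_B_Cons inv_coef_def sum_distrib_left blockings_def
        simp flip: sum_negf intro!: sum.cong)
  finally have "inv_coef ms k + (\<Sum>i=1..length ms. real ((sum_list (drop i ms) + k) choose i) * inv_coef (drop i ms) k) = 0"
    by (simp add: sum_negf)
  then show ?thesis by (simp add: atMost_atLeast0 sum.atLeast_Suc_atMost)
qed

text \<open>The exponent of the sign is the number of blocks in \<open>inv_coef\<close>, but one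
  less in \<open>coef_U\<close>.\<close>

lemma coef_U_eq:
  assumes "ms \<noteq> []"
  shows "coef_U ms k = - inv_coef ms k"
proof -
  have "coef_U ms k = (\<Sum>i = 1..length ms. \<Sum>mss\<in>splittings i ms. (-1) ^ (length mss - 1) * coef_B k mss)"
    unfolding coef_U_def sum_distrib_left by (intro sum.cong refl) (simp add: splittings_def)
  also have "\<dots> = (\<Sum>mss\<in>blockings ms. (-1) ^ (length mss - 1) * coef_B k mss)"
    by (rule sum_splittings[OF assms])
  also have "\<dots> = - inv_coef ms k"
    unfolding inv_coef_def sum_negf[symmetric]
  proof (intro sum.cong refl)
    fix mss assume "mss \<in> blockings ms"
    with assms obtain p q where "mss = p # q" by (cases mss) (auto simp: blockings_def)
    then show "(-1) ^ (length mss - 1) * coef_B k mss =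
        - ((-1) ^ length mss * (if mss = [] then 1 else coef_B k mss))" by simp
  qed
  finally show ?thesis .
qed

text \<open>Joins both cases of \<open>cm_beta\<close>: for empty \<open>w\<close> only the blocking
  \<open>[]\<close> is left, where \<open>inv_coef\<close> and \<open>coef_A\<close> are 1, giving
  the initial value -1.\<close>

lemma cm_beta_snoc:
  "cm_beta (w @ [k]) = - (\<Sum>nss\<in>blockings w. inv_coef (map sum_list nss) k * coef_A nss)"
proof (cases "w = []")
  case True
  then show ?thesis by (simp add: cm_beta_def coef_A_def)
next
  case False
  then have "cm_beta (w @ [k]) = (\<Sum>nss\<in>blockings w. coef_U (map sum_list nss) k * coef_A nss)"
    by (simp add: cm_beta_def sum_splittings del: One_nat_def)
  also have "\<dots> = (\<Sum>nss\<in>blockings w. - (inv_coef (map sum_list nss) k * coef_A nss))"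
  proof (intro sum.cong refl)
    fix nss assume "nss \<in> blockings w"
    with False have "map sum_list nss \<noteq> []" by (auto simp: blockings_def)
    then show "coef_U (map sum_list nss) k * coef_A nss = - (inv_coef (map sum_list nss) k * coef_A nss)"
      by (simp add: coef_U_eq)
  qed
  finally show ?thesis by (simp add: sum_negf)
qed

section \<open>Inverting composition with a formal diffeomorphism\<close>

text \<open>
  \<open>exp_coef\<close>, \<open>diff_coef\<close> and \<open>power_coef a j n\<close> are the coefficients of \<open>x\<^sup>n\<close>, \<open>x\<^sup>m\<^sup>+\<^sup>1\<close> and \<open>x\<^sup>j\<close> in \<open>\<phi>'\<close>, \<open>\<phi>\<close>
  and \<open>\<phi>\<^sup>n\<close>; \<open>antipode_coef a n\<close> is the claimed value of \<open>S(\<delta>\<^sub>n) / n!\<close>.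
\<close>

definition exp_coef :: "(nat \<Rightarrow> 'a::real_algebra_1) \<Rightarrow> nat \<Rightarrow> 'a" where
  "exp_coef a n = (\<Sum>w\<in>compositions n. (1 / fact (length w)) *\<^sub>R prod_list (map a w))"

definition diff_coef :: "(nat \<Rightarrow> 'a::real_algebra_1) \<Rightarrow> nat \<Rightarrow> 'a" where
  "diff_coef a m = (1 / (real m + 1)) *\<^sub>R exp_coef a m"

lemma coef_A_Cons: "coef_A (ns # nss) = 1 / fact (length ns) * (1 / (real (sum_list ns) + 1)) * coef_A nss"
  by (simp add: coef_A_def)

text \<open>\<open>coef_A\<close> and the monomial are multiplicative over the blocks, and the sum
  over one block of weight \<open>m\<close> is \<open>diff_coef a m\<close>. The order of the
  factors is kept, as the algebra may be noncommutative.\<close>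

lemma sum_block_lists_coef_A:
  "(\<Sum>nss\<in>block_lists ms. coef_A nss *\<^sub>R prod_list (map a (concat nss))) = prod_list (map (diff_coef a) ms)"
proof (induction ms)
  case (Cons m ms)
  have "(\<Sum>nss\<in>block_lists (m # ms). coef_A nss *\<^sub>R prod_list (map a (concat nss))) =
      (\<Sum>ns\<in>compositions m. \<Sum>nss\<in>block_lists ms.
        ((1 / (real m + 1)) *\<^sub>R ((1 / fact (length ns)) *\<^sub>R prod_list (map a ns))) *
        (coef_A nss *\<^sub>R prod_list (map a (concat nss))))"
    unfolding sum_block_lists_Cons
    by (intro sum.cong refl) (simp add: coef_A_Cons sum_list_compositions)
  also have "\<dots> = prod_list (map (diff_coef a) (m # ms))"
    by (simp only: sum_product[symmetric] scaleR_sum_right[symmetric] Cons.IH exp_coef_def[symmetric]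
        diff_coef_def[symmetric] list.map prod_list.Cons)
  finally show ?case .
qed (simp add: coef_A_def)

definition power_coef :: "(nat \<Rightarrow> 'a::real_algebra_1) \<Rightarrow> nat \<Rightarrow> nat \<Rightarrow> 'a" where
  "power_coef a j n = (if j < n then 0 else
     (\<Sum>p\<in>compositions (j - n). real (n choose length p) *\<^sub>R prod_list (map (diff_coef a) p)))"

definition antipode_coef :: "(nat \<Rightarrow> 'a::real_algebra_1) \<Rightarrow> nat \<Rightarrow> 'a" where
  "antipode_coef a n = (if n = 0 then 0 else \<Sum>ns\<in>compositions n. cm_beta ns *\<^sub>R prod_list (map a ns))"

text \<open>Splitting off the last entry \<open>k\<close> and regrouping the rest by block weights
  contracts the \<open>coef_A\<close> sums to coefficients of \<open>\<phi>\<close>. What remains is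
  \<open>r = - M\<^sup>-\<^sup>1 a\<close>; the inner sum is the entry of
  \<open>M\<^sup>-\<^sup>1\<close> in row \<open>n\<close> and column \<open>k\<close>.\<close>

lemma antipode_coef_inv:
  "antipode_coef a n = - (\<Sum>k=1..n. (\<Sum>ms\<in>compositions (n - k).
     inv_coef ms k *\<^sub>R prod_list (map (diff_coef a) ms)) * a k)"
proof (cases "n = 0")
  case False
  have "antipode_coef a n =
      - (\<Sum>k=1..n. (\<Sum>w\<in>compositions (n - k). \<Sum>nss\<in>blockings w.
          (inv_coef (map sum_list nss) k * coef_A nss) *\<^sub>R prod_list (map a (concat nss))) * a k)"
    using False
    by (simp add: antipode_coef_def sum_compositions_snoc cm_beta_snoc sum_negf sum_distrib_right
        scaleR_sum_left blockings_def del: One_nat_def)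
  also have "\<dots> = - (\<Sum>k=1..n. (\<Sum>ms\<in>compositions (n - k).
     inv_coef ms k *\<^sub>R prod_list (map (diff_coef a) ms)) * a k)"
    unfolding sum_blockings_compositions
  proof (intro arg_cong[where f = uminus] sum.cong refl arg_cong2[where f = "(*)"])
    fix k ms assume ms: "ms \<in> compositions (n - k)"
    have "map sum_list nss = ms" if "nss \<in> block_lists ms" for nss
      using that by (auto simp: block_lists_def list_all2_conv_all_nth compositions_def intro: nth_equalityI)
    then have "(\<Sum>nss\<in>block_lists ms. (inv_coef (map sum_list nss) k * coef_A nss) *\<^sub>R prod_list (map a (concat nss)))
      = inv_coef ms k *\<^sub>R (\<Sum>nss\<in>block_lists ms. coef_A nss *\<^sub>R prod_list (map a (concat nss)))"
      unfolding scaleR_sum_right by (intro sum.cong refl) simp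
    then show "(\<Sum>nss\<in>block_lists ms. (inv_coef (map sum_list nss) k * coef_A nss) *\<^sub>R prod_list (map a (concat nss)))
      = inv_coef ms k *\<^sub>R prod_list (map (diff_coef a) ms)"
      by (simp only: sum_block_lists_coef_A)
  qed
  finally show ?thesis .
qed (simp add: antipode_coef_def)

text \<open>The entry \<open>(N + k, k)\<close> of \<open>M M\<^sup>-\<^sup>1\<close>. Since
  \<open>m\<close> is the weight of \<open>q\<close>, gluing \<open>p\<close> and \<open>q\<close>
  produces the sums of \<open>inv_coef_rec\<close>, and every nonempty word cancels.\<close>

lemma power_coef_inv:
  "(\<Sum>m\<le>N. power_coef a (N + k) (m + k) * (\<Sum>q\<in>compositions m. inv_coef q k *\<^sub>R prod_list (map (diff_coef a) q)))
    = (if N = 0 then 1 else 0)"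
proof -
  have "(\<Sum>m\<le>N. power_coef a (N + k) (m + k) * (\<Sum>q\<in>compositions m. inv_coef q k *\<^sub>R prod_list (map (diff_coef a) q)))
    = (\<Sum>m\<le>N. \<Sum>q\<in>compositions m. \<Sum>p\<in>compositions (N - m).
       (real ((sum_list q + k) choose length p) * inv_coef q k) *\<^sub>R prod_list (map (diff_coef a) (p @ q)))"
    by (intro sum.cong refl)
       (simp add: power_coef_def sum_distrib_left sum_distrib_right sum_list_compositions scaleR_sum_right mult.commute)
  also have "\<dots> = (\<Sum>ms\<in>compositions N. \<Sum>i\<le>length ms.
      (real ((sum_list (drop i ms) + k) choose length (take i ms)) * inv_coef (drop i ms) k) *\<^sub>R
        prod_list (map (diff_coef a) (take i ms @ drop i ms)))"
    by (rule sum_compositions_append[symmetric])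
  also have "\<dots> = (\<Sum>ms\<in>compositions N. (\<Sum>i\<le>length ms.
      real ((sum_list (drop i ms) + k) choose i) * inv_coef (drop i ms) k) *\<^sub>R prod_list (map (diff_coef a) ms))"
    unfolding scaleR_sum_left by (intro sum.cong refl) simp
  also have "\<dots> = (\<Sum>ms\<in>compositions N. if ms = [] then 1 else 0)"
    by (intro sum.cong refl) (auto simp: inv_coef_rec)
  also have "\<dots> = (if N = 0 then 1 else 0)"
    by (rule sum_compositions_Nil)
  finally show ?thesis .
qed

text \<open>The equation \<open>M r = - a\<close>, with entry 0 in row 0. After
  \<open>antipode_coef_inv\<close> and an exchange of sums, \<open>power_coef_inv\<close> leaves
  only \<open>k = j\<close>.\<close>

lemma sum_power_coef_antipode_coef:
  "(\<Sum>n\<le>j. power_coef a j n * antipode_coef a n) = - (if j = 0 then 0 else a j)"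
proof -
  define V where "V = (\<lambda>m k. \<Sum>q\<in>compositions m. inv_coef q k *\<^sub>R prod_list (map (diff_coef a) q))"
  have V: "antipode_coef a n = - (\<Sum>k=1..n. V (n - k) k * a k)" for n
    unfolding V_def by (rule antipode_coef_inv)
  have "(\<Sum>n\<le>j. power_coef a j n * antipode_coef a n) =
      - (\<Sum>n\<le>j. \<Sum>k=1..n. power_coef a j n * V (n - k) k * a k)"
    by (simp add: V sum_distrib_left sum_negf mult.assoc)
  also have "(\<Sum>n\<le>j. \<Sum>k=1..n. power_coef a j n * V (n - k) k * a k) =
      (\<Sum>k=1..j. \<Sum>n=k..j. power_coef a j n * V (n - k) k * a k)"
  proof -
    have "(\<Sum>n\<le>j. \<Sum>k=1..n. power_coef a j n * V (n - k) k * a k) =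
      (\<Sum>n\<le>j. \<Sum>k | k \<in> {1..j} \<and> k \<le> n. power_coef a j n * V (n - k) k * a k)"
      by (intro sum.cong refl) auto
    also have "\<dots> = (\<Sum>k=1..j. \<Sum>n | n \<in> {..j} \<and> k \<le> n. power_coef a j n * V (n - k) k * a k)"
      by (rule sum.swap_restrict) auto
    also have "\<dots> = (\<Sum>k=1..j. \<Sum>n=k..j. power_coef a j n * V (n - k) k * a k)"
      by (intro sum.cong refl) auto
    finally show ?thesis .
  qed
  also have "\<dots> = (\<Sum>k=1..j. (\<Sum>m\<le>j - k. power_coef a (j - k + k) (m + k) * V m k) * a k)"
  proof (rule sum.cong[OF refl])
    fix k assume k: "k \<in> {1..j}"
    have "(\<Sum>n=k..j. power_coef a j n * V (n - k) k * a k) =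
        (\<Sum>m\<le>j - k. power_coef a j (m + k) * V m k * a k)"
      by (rule sum.reindex_bij_witness[where i = "\<lambda>m. m + k" and j = "\<lambda>n. n - k"]) (use k in auto)
    with k show "(\<Sum>n=k..j. power_coef a j n * V (n - k) k * a k) =
        (\<Sum>m\<le>j - k. power_coef a (j - k + k) (m + k) * V m k) * a k"
      by (simp add: sum_distrib_right)
  qed
  also have "\<dots> = (\<Sum>k=1..j. if k = j then a k else 0)"
    unfolding V_def power_coef_inv by (intro sum.cong refl) auto
  also have "\<dots> = (if j = 0 then 0 else a j)"
    by (auto simp: Suc_le_eq)
  finally show ?thesis .
qed

section \<open>Commutation of the coefficients and their generating power series\<close>

lemma commute_sum_prod_list:
  fixes u :: "'a::real_algebra_1"
  assumes "\<And>k. u * a k = a k * u"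
  shows "u * (\<Sum>w\<in>W. f w *\<^sub>R prod_list (map a w)) = (\<Sum>w\<in>W. f w *\<^sub>R prod_list (map a w)) * u"
proof -
  have "u * prod_list (map a w) = prod_list (map a w) * u" for w
    by (induction w) (simp_all add: assms flip: mult.assoc, simp add: assms mult.assoc)
  then show ?thesis by (simp add: sum_distrib_left sum_distrib_right)
qed

lemma commute_exp_coef:
  "(\<And>k. u * a k = a k * u) \<Longrightarrow> u * exp_coef a n = exp_coef a n * u"
  unfolding exp_coef_def by (rule commute_sum_prod_list)

lemma commute_diff_coef:
  "(\<And>k. u * a k = a k * u) \<Longrightarrow> u * diff_coef a n = diff_coef a n * u"
  unfolding diff_coef_def by (simp add: commute_exp_coef)

lemma commute_power_coef:
  "(\<And>k. u * a k = a k * u) \<Longrightarrow> u * power_coef a j n = power_coef a j n * u"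
  unfolding power_coef_def by (simp add: commute_sum_prod_list commute_diff_coef)

text \<open>Without a constant term every factor of the power contributes a positive index, so the
  indices form a composition with \<open>l\<close> entries.\<close>

lemma fps_power_compositions:
  assumes "f $ 0 = (0 :: 'a::real_algebra_1)"
  shows "(f ^ l) $ n = (\<Sum>w\<in>compositions n. if length w = l then prod_list (map (($) f) w) else 0)"
proof (induction l arbitrary: n)
  case 0
  show ?case using sum_compositions_Nil[of "\<lambda>w. prod_list (map (($) f) w)" n] by simp
next
  case (Suc l)
  show ?case
  proof (cases "n = 0")
    case False
    have "(f ^ Suc l) $ n = (\<Sum>i=1..n. f $ i * (f ^ l) $ (n - i))"
      using assms by (simp add: fps_mult_nth sum.atLeast_Suc_atMost)
    then show ?thesis using False
      by (simp add: Suc.IH sum_compositions_Cons sum_distrib_left if_distrib[of "\<lambda>x. _ * x"] del: One_nat_def cong: if_cong)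
  qed (simp add: assms)
qed

text \<open>A composition of \<open>n\<close> has at most \<open>n\<close> entries, so the
  exponential series may be cut at any \<open>L \<ge> n\<close>. The freedom in \<open>L\<close>
  lets the coefficients \<open>n\<close> and \<open>n + 1\<close> share one truncation.\<close>

lemma exp_coef_fps:
  fixes a :: "nat \<Rightarrow> 'a::real_algebra_1"
  assumes "a 0 = 0" and "n \<le> L"
  shows "exp_coef a n = (\<Sum>l\<le>L. (1 / fact l) *\<^sub>R ((Abs_fps a ^ l) $ n))"
proof -
  have "length w \<le> L" if "w \<in> compositions n" for w
  proof -
    have "\<forall>k\<in>set w. k \<ge> 1 \<Longrightarrow> length w \<le> sum_list w" by (induction w) auto
    with that assms show ?thesis by (simp add: compositions_def)
  qed
  moreover have "(\<lambda>n. a n) = a" by simp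
  ultimately have "exp_coef a n =
      (\<Sum>w\<in>compositions n. \<Sum>l\<le>L. (1 / fact l) *\<^sub>R (if length w = l then prod_list (map a w) else 0))"
    unfolding exp_coef_def 
    by (intro sum.cong refl) (simp add: if_distrib[of "\<lambda>x. _ *\<^sub>R x"] cong: if_cong)
  also have "\<dots> = (\<Sum>l\<le>L. (1 / fact l) *\<^sub>R ((Abs_fps a ^ l) $ n))"
    using assms by (subst sum.swap) (simp add: fps_power_compositions scaleR_sum_right cong: if_cong map_cong)
  finally show ?thesis .
qed

text \<open>The induction multiplies by \<open>\<phi>\<close> on the left: the constant coefficient
  1 of \<open>\<phi> / x\<close> keeps a word, the coefficient at \<open>k \<ge> 1\<close> puts
  \<open>k\<close> in front, and Pascal's rule adds the two binomials.\<close>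

lemma power_coef_fps: "power_coef a j n = ((fps_X * Abs_fps (diff_coef a)) ^ n) $ j"
proof (induction n arbitrary: j)
  case 0
  have "(\<Sum>p\<in>compositions j. real (0 choose length p) *\<^sub>R prod_list (map (diff_coef a) p)) =
      (\<Sum>p\<in>compositions j. if p = [] then 1 else 0)"
    by (intro sum.cong refl) auto
  then show ?case by (simp add: power_coef_def sum_compositions_Nil)
next
  case (Suc n)
  let ?C = "Abs_fps (diff_coef a)"
  let ?p = "\<lambda>w. prod_list (map (diff_coef a) w)"
  have d0: "diff_coef a 0 = 1" by (simp add: diff_coef_def exp_coef_def)
  show ?case
  proof (cases j)
    case (Suc i)
    have "((fps_X * ?C) ^ Suc n) $ j = (\<Sum>k=0..i. diff_coef a k * power_coef a (i - k) n)"
    proof -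
      have "((fps_X * ?C) ^ Suc n) $ j = (fps_X * (?C * (fps_X * ?C) ^ n)) $ j"
        by (simp only: power_Suc mult.assoc)
      also have "\<dots> = (?C * (fps_X * ?C) ^ n) $ i" by (simp add: Suc)
      finally show ?thesis by (simp add: fps_mult_nth Suc.IH)
    qed
    also have "\<dots> = power_coef a j (Suc n)"
    proof (cases "i < n")
      case True
      then show ?thesis by (auto simp: Suc power_coef_def intro!: sum.neutral)
    next
      case False
      define m where "m = i - n"
      have i: "i = m + n" using False by (simp add: m_def)
      have "(\<Sum>k=0..i. diff_coef a k * power_coef a (i - k) n) =
          (\<Sum>k=0..m. diff_coef a k * power_coef a (i - k) n)"
        by (rule sum.mono_neutral_right) (auto simp: i power_coef_def)
      also have "\<dots> = (\<Sum>k=0..m. diff_coef a k * (\<Sum>p\<in>compositions (m - k). real (n choose length p) *\<^sub>R ?p p))"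
        by (intro sum.cong refl) (auto simp: i power_coef_def)
      also have "\<dots> = (\<Sum>p\<in>compositions m. real (n choose length p) *\<^sub>R ?p p) +
          (\<Sum>k=1..m. \<Sum>p\<in>compositions (m - k). real (n choose length p) *\<^sub>R ?p (k # p))"
        by (simp add: sum.atLeast_Suc_atMost d0 sum_distrib_left)
      also have "(\<Sum>k=1..m. \<Sum>p\<in>compositions (m - k). real (n choose length p) *\<^sub>R ?p (k # p)) =
          (\<Sum>p\<in>compositions m. (if p = [] then 0 else real (n choose (length p - 1))) *\<^sub>R ?p p)"
        by (cases "m = 0") (simp_all add: sum_compositions_Cons del: One_nat_def)
      also have "(\<Sum>p\<in>compositions m. real (n choose length p) *\<^sub>R ?p p) + \<dots> =
          (\<Sum>p\<in>compositions m. real (Suc n choose length p) *\<^sub>R ?p p)"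
        unfolding sum.distrib[symmetric] scaleR_left_distrib[symmetric]
      proof (intro sum.cong refl arg_cong2[where f = scaleR])
        fix p :: "nat list"
        show "real (n choose length p) + (if p = [] then 0 else real (n choose (length p - 1))) =
            real (Suc n choose length p)" by (cases p) simp_all
      qed
      finally show ?thesis by (simp add: Suc i power_coef_def)
    qed
    finally show ?thesis by simp
  qed (simp add: power_coef_def)
qed

section \<open>The recursion for the inverse\<close>

lemma of_nat_mult_scaleR: "of_nat n * x = real n *\<^sub>R (x :: 'a::real_algebra_1)"
  by (simp add: scaleR_conv_of_real)

text \<open>Its coefficient \<open>n\<close> compares the commutator of \<open>x\<close> with
  \<open>f $ n\<close> to \<open>n + 1\<close> times \<open>f $ (n + 1)\<close>, so that recursions
  in the index become differential equations.\<close>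

definition ad_deriv :: "'a::ring_1 \<Rightarrow> 'a fps \<Rightarrow> 'a fps" where
  "ad_deriv x f = fps_const x * f - f * fps_const x - fps_deriv f"

lemma ad_deriv_nth:
  fixes f :: "'a::real_algebra_1 fps"
  shows "ad_deriv x f $ n = x * f $ n - f $ n * x - real (n + 1) *\<^sub>R (f $ (n + 1))"
  unfolding of_nat_mult_scaleR[symmetric] by (simp add: ad_deriv_def)

lemma mult_of_nat_left_commute: "f * (of_nat n * g) = of_nat n * (f * g :: 'a::semiring_1)"
  by (metis mult.assoc mult_of_nat_commute)

lemma ad_deriv_mult: "ad_deriv x (f * g) = ad_deriv x f * g + f * ad_deriv x g"
  by (simp add: ad_deriv_def algebra_simps)

lemma ad_deriv_one: "ad_deriv x 1 = 0"
  by (simp add: ad_deriv_def)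

text \<open>Leibniz rule, to be applied to \<open>f = log \<phi>'\<close>. The truncated exponent
  \<open>l - 1\<close> at \<open>l = 0\<close> is harmless because of the factor
  \<open>of_nat l\<close>.\<close>

lemma ad_deriv_power_log:
  assumes f: "ad_deriv x f = - U" and comm: "f * U = U * f"
  shows "ad_deriv x (f ^ l) = - (of_nat l * (U * f ^ (l - 1)))"
proof (induction l)
  case (Suc l)
  have *: "of_nat l * (f * (U * f ^ (l - 1))) = of_nat l * (U * f ^ l)"
  proof (cases l)
    case (Suc k)
    have "f * (U * f ^ k) = U * f ^ Suc k" by (simp add: comm flip: mult.assoc)
    then show ?thesis by (simp add: Suc)
  qed simp
  have "ad_deriv x (f ^ Suc l) = - (U * f ^ l) - f * (of_nat l * (U * f ^ (l - 1)))"
    by (simp add: ad_deriv_mult f Suc.IH)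
  also have "\<dots> = - (of_nat (Suc l) * (U * f ^ l))"
    unfolding mult_of_nat_left_commute * by (simp add: algebra_simps)
  finally show ?case by simp
qed (simp add: ad_deriv_one)

text \<open>Leibniz rule, to be applied to \<open>f = \<phi>\<close>: the term \<open>- 1\<close>
  lowers the exponent, the other one multiplies by \<open>U\<close>.\<close>

lemma ad_deriv_power_diff:
  assumes f: "ad_deriv x f = - 1 - U * f" and comm: "f * U = U * f"
  shows "ad_deriv x (f ^ n) = - (of_nat n * f ^ (n - 1)) - of_nat n * (U * f ^ n)"
proof (induction n)
  case (Suc n)
  have *: "of_nat n * (f * f ^ (n - 1)) = of_nat n * f ^ n"
    by (cases n) simp_all
  have "ad_deriv x (f ^ Suc n) = (- 1 - U * f) * f ^ n - f * (of_nat n * f ^ (n - 1)) - f * (of_nat n * (U * f ^ n))"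
    by (simp add: ad_deriv_mult f Suc.IH right_diff_distrib)
  also have "\<dots> = (- 1 - U * f) * f ^ n - of_nat n * f ^ n - of_nat n * (U * f ^ Suc n)"
    unfolding mult_of_nat_left_commute * by (simp add: comm flip: mult.assoc[of f] mult.assoc[of U])
  also have "\<dots> = - (of_nat (Suc n) * f ^ n) - of_nat (Suc n) * (U * f ^ Suc n)"
    by (simp add: algebra_simps)
  finally show ?case by simp
qed (simp add: ad_deriv_one)

text \<open>Modelled on \<open>x = X\<close> and \<open>a\<^sub>k = \<delta>\<^sub>k / k!\<close>,
  for which \<open>[X, \<delta>\<^sub>k] = \<delta>\<^sub>k\<^sub>+\<^sub>1\<close> becomes
  \<open>ad\<close>. It starts at \<open>k = 1\<close>, because \<open>a 0 = 0\<close> commutes with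
  \<open>x\<close> while \<open>a 1\<close> may be nonzero.\<close>

context
  fixes x :: "'a::real_algebra_1" and a :: "nat \<Rightarrow> 'a"
  assumes a0: "a 0 = 0"
    and ad: "\<And>k. k \<ge> 1 \<Longrightarrow> x * a k - a k * x = real (k + 1) *\<^sub>R a (k + 1)"
    and comm: "\<And>k. a 1 * a k = a k * a 1"
begin

text \<open>\<open>ad_deriv x\<close> maps \<open>log \<phi>'\<close> to the constant
  \<open>- a 1\<close>, hence its exponential \<open>\<phi>'\<close> to
  \<open>- a 1 * \<phi>'\<close>; compare coefficients.\<close>

lemma ad_exp_coef:
  "x * exp_coef a n - exp_coef a n * x = real (n + 1) *\<^sub>R exp_coef a (n + 1) - a 1 * exp_coef a n"
proof -
  let ?F = "Abs_fps a" and ?U = "fps_const (a 1)"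
  have F: "ad_deriv x ?F = - ?U"
    using ad by (auto simp: fps_eq_iff ad_deriv_nth a0 of_nat_mult_scaleR fps_const_def)
  have FU: "?F * ?U = ?U * ?F"
    by (simp add: fps_eq_iff comm del: One_nat_def)
  have "x * exp_coef a n - exp_coef a n * x - real (n + 1) *\<^sub>R exp_coef a (n + 1) =
      (\<Sum>l\<le>n + 1. (1 / fact l) *\<^sub>R (ad_deriv x (?F ^ l) $ n))"
    by (simp add: exp_coef_fps[of a _ "n + 1", OF a0] sum_distrib_left sum_distrib_right ad_deriv_nth
        scaleR_sum_right sum_subtractf scaleR_diff_right of_nat_mult_scaleR mult.commute del: sum.atMost_Suc power_Suc)
  also have "\<dots> = (\<Sum>l\<le>n + 1. - ((real l / fact l) *\<^sub>R (a 1 * (?F ^ (l - 1)) $ n)))"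
    unfolding ad_deriv_power_log[OF F FU]
    by (intro sum.cong refl) (simp add: of_nat_mult_scaleR fps_of_nat[symmetric] del: One_nat_def)
  \<comment> \<open>The factor \<open>l\<close> kills the term \<open>l = 0\<close> and turns
    \<open>1 / l!\<close> into \<open>1 / (l - 1)!\<close>, so the sum shifts down by one.\<close>
  also have "\<dots> = - (\<Sum>l\<le>n. (1 / fact l) *\<^sub>R (a 1 * (?F ^ l) $ n))"
    by (simp add: sum_negf sum.atMost_Suc_shift divide_simps del: sum.atMost_Suc)
  also have "\<dots> = - (a 1 * exp_coef a n)"
    by (simp add: exp_coef_fps[of a _ n, OF a0] sum_distrib_left)
  finally show ?thesis by (simp add: algebra_simps)
qed

lemma ad_diff_coef:
  "x * diff_coef a n - diff_coef a n * x = real (n + 2) *\<^sub>R diff_coef a (n + 1) - a 1 * diff_coef a n"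
proof -
  have "x * diff_coef a n - diff_coef a n * x = (1 / (real n + 1)) *\<^sub>R (x * exp_coef a n - exp_coef a n * x)"
    by (simp add: diff_coef_def scaleR_diff_right)
  also have "\<dots> = real (n + 2) *\<^sub>R diff_coef a (n + 1) - a 1 * diff_coef a n"
    unfolding ad_exp_coef by (simp add: diff_coef_def scaleR_diff_right add.commute[of 1])
  finally show ?thesis .
qed

text \<open>Coefficient \<open>j\<close> of \<open>ad_deriv x\<close> at
  \<open>\<phi>\<^sup>n\<close>, found by the power rule from the image
  \<open>- 1 - a 1 * \<phi>\<close> of \<open>\<phi>\<close>; the \<open>- 1\<close> produces column
  \<open>n - 1\<close>.\<close>

lemma ad_power_coef:
  "x * power_coef a j n - power_coef a j n * x = real (j + 1) *\<^sub>R power_coef a (j + 1) n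
     - real n *\<^sub>R power_coef a j (n - 1) - real n *\<^sub>R (a 1 * power_coef a j n)"
proof -
  let ?f = "fps_X * Abs_fps (diff_coef a)" and ?U = "fps_const (a 1)"
  have f: "ad_deriv x ?f = - 1 - ?U * ?f"
  proof (rule fps_ext)
    fix n
    show "ad_deriv x ?f $ n = (- 1 - ?U * ?f) $ n"
    proof (cases n)
      case 0
      then show ?thesis by (simp add: ad_deriv_nth diff_coef_def exp_coef_def)
    next
      case (Suc m)
      then show ?thesis using ad_diff_coef[of m]
        by (simp add: ad_deriv_nth algebra_simps)
    qed
  qed
  have fU: "?f * ?U = ?U * ?f"
    by (simp add: fps_eq_iff commute_diff_coef[of "a 1" a, OF comm] del: One_nat_def)
  have "ad_deriv x (?f ^ n) $ j = (- (of_nat n * ?f ^ (n - 1)) - of_nat n * (?U * ?f ^ n)) $ j"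
    unfolding ad_deriv_power_diff[OF f fU] ..
  then show ?thesis
    by (simp add: ad_deriv_nth of_nat_mult_scaleR power_coef_fps[symmetric] fps_of_nat[symmetric] algebra_simps
        del: One_nat_def)
qed

text \<open>Commuting \<open>x\<close> with \<open>M r = - a\<close> and inserting
  \<open>ad_power_coef\<close> gives \<open>M z = 0\<close> for the defect \<open>z\<close> of the
  recursion; \<open>M\<close> is unitriangular, so \<open>z = 0\<close>. The correction at
  \<open>n = 0\<close> accounts for \<open>r\<^sub>0 = 0\<close> and
  \<open>r\<^sub>1 = - a\<^sub>1\<close>.\<close>

lemma antipode_coef_Suc:
  "real (n + 1) *\<^sub>R antipode_coef a (n + 1) =
     x * antipode_coef a n - antipode_coef a n * x - real n *\<^sub>R (a 1 * antipode_coef a n)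
     - (if n = 0 then a 1 else 0)"
proof -
  let ?M = "power_coef a" and ?r = "antipode_coef a"
  define z where "z n = real (n + 1) *\<^sub>R ?r (n + 1) + real n *\<^sub>R (a 1 * ?r n) - (x * ?r n - ?r n * x)
    + (if n = 0 then a 1 else 0)" for n
  have M1: "?M j j = 1" and M0: "?M j 0 = (if j = 0 then 1 else 0)" for j
    by (simp add: power_coef_def, simp add: power_coef_fps)
  have MSuc: "?M j (Suc j) = 0" for j by (simp add: power_coef_def)
  have "(\<Sum>n\<le>j. ?M j n * z n) = 0" for j
  proof -
    \<comment> \<open>Column \<open>Suc j\<close> of row \<open>j\<close> is zero, but including it
      makes room for row \<open>Suc j\<close> and for the column shift \<open>n - 1\<close>.\<close>
    have "x * (\<Sum>n\<le>Suc j. ?M j n * ?r n) - (\<Sum>n\<le>Suc j. ?M j n * ?r n) * x =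
        (\<Sum>n\<le>Suc j. (x * ?M j n - ?M j n * x) * ?r n) + (\<Sum>n\<le>Suc j. ?M j n * (x * ?r n - ?r n * x))"
      by (simp only: sum_distrib_left sum_distrib_right flip: sum.distrib sum_subtractf)
         (simp add: algebra_simps del: sum.atMost_Suc)
    also have "(\<Sum>n\<le>Suc j. (x * ?M j n - ?M j n * x) * ?r n) =
        real (j + 1) *\<^sub>R (\<Sum>n\<le>Suc j. ?M (Suc j) n * ?r n)
        - (\<Sum>n\<le>Suc j. real n *\<^sub>R (?M j (n - 1) * ?r n))
        - (\<Sum>n\<le>Suc j. ?M j n * (real n *\<^sub>R (a 1 * ?r n)))"
      unfolding ad_power_coef
      by (simp add: left_diff_distrib sum_subtractf scaleR_sum_right commute_power_coef[of "a 1" a, OF comm]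
          mult.assoc del: sum.atMost_Suc One_nat_def flip: Suc_eq_plus1)
    also have "(\<Sum>n\<le>Suc j. real n *\<^sub>R (?M j (n - 1) * ?r n)) = (\<Sum>n\<le>j. ?M j n * (real (n + 1) *\<^sub>R ?r (n + 1)))"
      by (simp add: sum.atMost_Suc_shift del: sum.atMost_Suc)
    \<comment> \<open>By \<open>M r = - a\<close> this is a commutator with \<open>- a j\<close>;
      row 0 has the entry 0, so \<open>ad\<close> is needed only for
      \<open>j \<ge> 1\<close>.\<close>
    also have "x * (\<Sum>n\<le>Suc j. ?M j n * ?r n) - (\<Sum>n\<le>Suc j. ?M j n * ?r n) * x
        = (if j = 0 then 0 else - (real (j + 1) *\<^sub>R a (j + 1)))"
      using ad[of j] by (simp add: MSuc sum_power_coef_antipode_coef algebra_simps)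
    finally have "(\<Sum>n\<le>j. ?M j n * (real (n + 1) *\<^sub>R ?r (n + 1))) +
        (\<Sum>n\<le>j. ?M j n * (real n *\<^sub>R (a 1 * ?r n))) - (\<Sum>n\<le>j. ?M j n * (x * ?r n - ?r n * x)) =
        - (if j = 0 then a 1 else 0)"
      unfolding sum_power_coef_antipode_coef by (cases "j = 0") (simp_all add: MSuc algebra_simps)
    moreover have "(\<Sum>n\<le>j. ?M j n * (if n = 0 then a 1 else 0)) = (if j = 0 then a 1 else 0)"
      by (simp add: if_distrib[of "\<lambda>y. _ * y"] M0 cong: if_cong)
    ultimately show ?thesis
      unfolding z_def by (simp only: distrib_left right_diff_distrib sum.distrib sum_subtractf) simp
  qed
  then have "z n = 0"
  proof (induction n rule: less_induct)
    case (less n)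
    have "(\<Sum>m<n. ?M n m * z m) = 0" using less by (intro sum.neutral) auto
    with less.prems[of n] show ?case by (simp add: M1 flip: lessThan_Suc_atMost)
  qed
  then show ?thesis by (simp add: z_def algebra_simps)
qed

end

section \<open>Coassociativity and the recursion for the antipode\<close>

text \<open>\<open>antipode_on\<close> controls \<open>S\<close> only on \<open>hcm1\<close>,
  whereas the lifts to the tensor product call for maps linear on all of \<open>hcm\<close>.\<close>

lemma extend_linear_from_subspace:
  fixes f :: "'a::real_vector \<Rightarrow> 'b::real_vector"
  assumes V: "subspace V"
    and add: "\<And>x y. x \<in> V \<Longrightarrow> y \<in> V \<Longrightarrow> f (x + y) = f x + f y"
    and scale: "\<And>c x. x \<in> V \<Longrightarrow> f (c *\<^sub>R x) = c *\<^sub>R f x"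
  obtains g where "linear g" "\<And>x. x \<in> V \<Longrightarrow> g x = f x"
proof -
  obtain B where B: "B \<subseteq> V" "independent B" "V \<subseteq> span B"
    by (rule maximal_independent_subset)
  obtain g where g: "linear g" "\<forall>x\<in>B. g x = f x"
    using linear_independent_extend[OF B(2), of f] by blast
  have *: "x \<in> V \<and> g x = f x" if "x \<in> span B" for x
    using that
  proof (induction rule: span_induct_alt)
    case base
    show ?case using scale[of 0 0] subspace_0[OF V] by (simp add: linear_0[OF g(1)])
  next
    case (step c b y)
    then have b: "b \<in> V" "g b = f b" and y: "y \<in> V" "g y = f y" using B(1) g(2) by auto
    have "c *\<^sub>R b \<in> V" using b(1) V by (simp add: subspace_scale)
    with b y show ?case
      by (simp add: linear_add[OF g(1)] linear_scale[OF g(1)] subspace_add[OF V] add scale)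
  qed
  have "g x = f x" if "x \<in> V" for x using *[of x] B(3) that by blast
  with g(1) show thesis by (rule that)
qed

lemma subspace_hcm1: "subspace hcm1"
  by (simp add: subspace_def hcm1_closed)

lemma linear_eq_on_hcm1_tensor:
  assumes "t \<in> hcm1_tensor" "linear f" "linear g"
    and "\<And>a b. a \<in> hcm1 \<Longrightarrow> b \<in> hcm1 \<Longrightarrow> f (a \<otimes>\<^sub>t b) = g (a \<otimes>\<^sub>t b)"
  shows "f t = g t"
  using assms(1)
  by (induction rule: hcm1_tensor_induct)
     (simp_all add: assms(4) linear_0[OF assms(2)] linear_0[OF assms(3)] linear_add[OF assms(2)] linear_add[OF assms(3)])

lemma linear_eq_on_tprod:
  assumes "linear f" "linear g" "\<And>a b. f (a \<otimes>\<^sub>t b) = g (a \<otimes>\<^sub>t b)"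
  shows "f t = g t"
  by (induction t rule: tensor_induct)
     (simp_all add: linear_0[OF assms(1)] linear_0[OF assms(2)] linear_add[OF assms(1)] linear_add[OF assms(2)] assms(3))

lemma linear_comp: "linear f \<Longrightarrow> linear g \<Longrightarrow> linear (\<lambda>x. f (g x))"
  using linear_compose[of g f] by (simp add: o_def)

lemma linear_tprod_left: "linear (\<lambda>a. a \<otimes>\<^sub>t b)" and linear_tprod_right: "linear (\<lambda>b. a \<otimes>\<^sub>t b)"
  using bilinear_tprod by (auto simp: bilinear_def)

lemma linear_mult_left: "linear (\<lambda>a. a * (b :: 'a::real_algebra))"
  and linear_mult_right: "linear (\<lambda>b. a * (b :: 'a::real_algebra))"
  using bilinear_times by (auto simp: bilinear_def)

lemma algebra_hom_linear: "algebra_hom f \<Longrightarrow> linear f"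
  by (simp add: algebra_hom_def)

lemma algebra_hom_comp: "algebra_hom f \<Longrightarrow> algebra_hom g \<Longrightarrow> algebra_hom (\<lambda>x. f (g x))"
  by (simp add: algebra_hom_def linear_comp)

lemma algebra_hom_tensor_lift:
  assumes "bilinear \<beta>" and "\<beta> 1 1 = 1" and mult: "\<And>a b c d. \<beta> (a * c) (b * d) = \<beta> a b * \<beta> c d"
  shows "algebra_hom (tensor_lift \<beta>)"
proof -
  note L = linear_tensor_lift[OF assms(1)]
  note lift = tensor_lift_tprod[OF assms(1)]
  have tp: "tensor_lift \<beta> ((a \<otimes>\<^sub>t b) * v) = \<beta> a b * tensor_lift \<beta> v" for a b v
  proof (rule linear_eq_on_tprod[where f = "\<lambda>v. tensor_lift \<beta> ((a \<otimes>\<^sub>t b) * v)" and g = "\<lambda>v. \<beta> a b * tensor_lift \<beta> v"])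
    show "linear (\<lambda>v. tensor_lift \<beta> ((a \<otimes>\<^sub>t b) * v))" by (rule linear_comp[OF L linear_mult_right])
    show "linear (\<lambda>v. \<beta> a b * tensor_lift \<beta> v)" by (rule linear_comp[OF linear_mult_right L])
  qed (simp add: lift mult tprod_mult)
  have "tensor_lift \<beta> (u * v) = tensor_lift \<beta> u * tensor_lift \<beta> v" for u v
  proof (rule linear_eq_on_tprod[where f = "\<lambda>u. tensor_lift \<beta> (u * v)" and g = "\<lambda>u. tensor_lift \<beta> u * tensor_lift \<beta> v"])
    show "linear (\<lambda>u. tensor_lift \<beta> (u * v))" by (rule linear_comp[OF L linear_mult_left])
    show "linear (\<lambda>u. tensor_lift \<beta> u * tensor_lift \<beta> v)" by (rule linear_comp[OF linear_mult_left L])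
  qed (simp add: lift tp)
  moreover have "tensor_lift \<beta> 1 = 1" using assms(2) lift[of 1 1] by (simp add: tprod_one)
  ultimately show ?thesis by (simp add: algebra_hom_def L)
qed

lemma coproduct_hom: "algebra_hom coproduct"
  and coproduct_gens:
    "coproduct cm_Y = cm_Y \<otimes>\<^sub>t 1 + 1 \<otimes>\<^sub>t cm_Y"
    "coproduct cm_X = cm_X \<otimes>\<^sub>t 1 + 1 \<otimes>\<^sub>t cm_X + cm_delta 1 \<otimes>\<^sub>t cm_Y"
    "coproduct (cm_delta 1) = cm_delta 1 \<otimes>\<^sub>t 1 + 1 \<otimes>\<^sub>t cm_delta 1"
  using coproduct_spec by (auto simp: coproduct_spec_def)

section \<open>Coassociativity of the coproduct\<close>

definition assoc_left :: "(hcm, hcm) tensor \<Rightarrow> ((hcm, hcm) tensor, hcm) tensor" where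
  "assoc_left = tensor_lift (\<lambda>a b. coproduct a \<otimes>\<^sub>t b)"

text \<open>The map \<open>id \<otimes> \<Delta>\<close>, rebracketed to the left so that it has the
  same target as \<open>assoc_left\<close>.\<close>

definition assoc_right :: "(hcm, hcm) tensor \<Rightarrow> ((hcm, hcm) tensor, hcm) tensor" where
  "assoc_right = tensor_lift (\<lambda>a b. tensor_lift (\<lambda>c d. (a \<otimes>\<^sub>t c) \<otimes>\<^sub>t d) (coproduct b))"

lemma bilinear_assoc_left: "bilinear (\<lambda>a b :: hcm. coproduct a \<otimes>\<^sub>t b)"
  unfolding bilinear_def
  by (intro conjI allI linear_tprod_right linear_comp[OF linear_tprod_left] algebra_hom_linear coproduct_hom)

lemma bilinear_assoc_right_inner: "bilinear (\<lambda>c d :: hcm. ((a :: hcm) \<otimes>\<^sub>t (c :: hcm)) \<otimes>\<^sub>t d)"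
  unfolding bilinear_def
  by (intro conjI allI linear_tprod_right linear_comp[OF linear_tprod_left])

lemma bilinear_assoc_right:
  "bilinear (\<lambda>a b. tensor_lift (\<lambda>c d :: hcm. ((a :: hcm) \<otimes>\<^sub>t (c :: hcm)) \<otimes>\<^sub>t d) (coproduct b))"
proof -
  note L = linear_tensor_lift[OF bilinear_assoc_right_inner]
  \<comment> \<open>Here \<open>a\<close> is a parameter of the lifted map, so linearity in
    \<open>a\<close> comes from writing \<open>t\<close> as a sum of pure tensors.\<close>
  have lin: "linear (\<lambda>a. tensor_lift (\<lambda>c d :: hcm. ((a :: hcm) \<otimes>\<^sub>t (c :: hcm)) \<otimes>\<^sub>t d) t)" for t
  proof (induction t rule: tensor_induct)
    case zero
    show ?case by (simp add: linear_0[OF L] linear_zero)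
  next
    case (add c d u)
    then show ?case
      by (simp add: linear_add[OF L] tensor_lift_tprod[OF bilinear_assoc_right_inner] linear_compose_add
          linear_comp[OF linear_tprod_left] linear_tprod_left)
  qed
  show ?thesis unfolding bilinear_def
    by (intro conjI allI lin linear_comp[OF L] algebra_hom_linear coproduct_hom)
qed

text \<open>Both sides are algebra homomorphisms in \<open>h\<close>, so the generators
  \<open>cm_Y\<close>, \<open>cm_X\<close> and \<open>cm_delta 1\<close> suffice.\<close>

lemma coassociative: "assoc_left (coproduct h) = assoc_right (coproduct h)"
proof -
  note Ll = tensor_lift_tprod[OF bilinear_assoc_left] tensor_lift_tprod[OF bilinear_assoc_right]
    tensor_lift_tprod[OF bilinear_assoc_right_inner]
  have l: "algebra_hom assoc_left"
    unfolding assoc_left_def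
    by (rule algebra_hom_tensor_lift[OF bilinear_assoc_left])
       (simp_all add: algebra_homD[OF coproduct_hom] tprod_mult tprod_one)
  have r: "algebra_hom assoc_right"
    unfolding assoc_right_def
  proof (rule algebra_hom_tensor_lift[OF bilinear_assoc_right])
    show "tensor_lift (\<lambda>c d :: hcm. ((1 :: hcm) \<otimes>\<^sub>t (c :: hcm)) \<otimes>\<^sub>t d) (coproduct 1) = 1"
      using Ll(3)[of 1 1 1] by (simp add: algebra_homD[OF coproduct_hom] tprod_one)
    fix a b c d :: hcm
    let ?T = "\<lambda>a :: hcm. tensor_lift (\<lambda>x y :: hcm. (a \<otimes>\<^sub>t (x :: hcm)) \<otimes>\<^sub>t y)"
    have L: "linear (?T a)" for a by (rule linear_tensor_lift[OF bilinear_assoc_right_inner])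
    have tp: "?T (a * c) ((p \<otimes>\<^sub>t q) * t) = ((a \<otimes>\<^sub>t p) \<otimes>\<^sub>t q) * ?T c t" for p q t
    proof (rule linear_eq_on_tprod[where f = "\<lambda>t. ?T (a * c) ((p \<otimes>\<^sub>t q) * t)" and g = "\<lambda>t. ((a \<otimes>\<^sub>t p) \<otimes>\<^sub>t q) * ?T c t"])
      show "linear (\<lambda>t. ?T (a * c) ((p \<otimes>\<^sub>t q) * t))" by (rule linear_comp[OF L linear_mult_right])
      show "linear (\<lambda>t. ((a \<otimes>\<^sub>t p) \<otimes>\<^sub>t q) * ?T c t)" by (rule linear_comp[OF linear_mult_right L])
    qed (simp add: Ll tprod_mult)
    have "?T (a * c) (s * t) = ?T a s * ?T c t" for s t
    proof (rule linear_eq_on_tprod[where f = "\<lambda>s. ?T (a * c) (s * t)" and g = "\<lambda>s. ?T a s * ?T c t"])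
      show "linear (\<lambda>s. ?T (a * c) (s * t))" by (rule linear_comp[OF L linear_mult_left])
      show "linear (\<lambda>s. ?T a s * ?T c t)" by (rule linear_comp[OF linear_mult_left L])
    qed (simp add: Ll tp)
    then show "tensor_lift (\<lambda>x y. ((a * c) \<otimes>\<^sub>t x) \<otimes>\<^sub>t y) (coproduct (b * d)) =
        tensor_lift (\<lambda>x y. (a \<otimes>\<^sub>t x) \<otimes>\<^sub>t y) (coproduct b) * tensor_lift (\<lambda>x y. (c \<otimes>\<^sub>t x) \<otimes>\<^sub>t y) (coproduct d)"
      by (simp add: algebra_homD[OF coproduct_hom])
  qed
  have tp: "assoc_left (a \<otimes>\<^sub>t b) = coproduct a \<otimes>\<^sub>t b"
    "assoc_right (a \<otimes>\<^sub>t b) = tensor_lift (\<lambda>c d. (a \<otimes>\<^sub>t c) \<otimes>\<^sub>t d) (coproduct b)" for a b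
    by (simp_all add: assoc_left_def assoc_right_def Ll)
  have inner: "tensor_lift (\<lambda>(c :: hcm) d :: hcm. (a \<otimes>\<^sub>t c) \<otimes>\<^sub>t d) 1 = (a \<otimes>\<^sub>t 1) \<otimes>\<^sub>t 1" for a :: hcm
    using Ll(3)[of a 1 1] by (simp add: tprod_one)
  note simps = coproduct_gens algebra_homD[OF coproduct_hom] algebra_homD[OF l] algebra_homD[OF r] tp inner Ll
    linear_add[OF linear_tensor_lift[OF bilinear_assoc_right_inner]] tprod_add_left tprod_add_right tprod_one
  show ?thesis
    by (rule hcm_hom_eqI[OF algebra_hom_comp[OF l coproduct_hom] algebra_hom_comp[OF r coproduct_hom]])
       (simp_all add: simps flip: tprod_one del: One_nat_def)
qed

section \<open>The commutator with X and cancellation in convolutions\<close>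

definition coproduct_ad :: "hcm \<Rightarrow> hcm \<Rightarrow> (hcm, hcm) tensor" where
  "coproduct_ad a b = (cm_X * a - a * cm_X) \<otimes>\<^sub>t b + a \<otimes>\<^sub>t (cm_X * b - b * cm_X)
     + (cm_delta 1 * a) \<otimes>\<^sub>t (cm_Y * b - b * cm_Y)"

lemmas linear_commutator = linear_compose_sub[OF linear_mult_right linear_mult_left]

lemma bilinear_coproduct_ad: "bilinear coproduct_ad"
  unfolding bilinear_def coproduct_ad_def
  by (intro conjI allI linear_compose_add linear_comp[OF linear_tprod_left] linear_comp[OF linear_tprod_right]
      linear_tprod_left linear_tprod_right linear_commutator linear_mult_right)

text \<open>\<open>coproduct_ad\<close> is the commutator with \<open>\<Delta> X\<close> in a form
  that keeps both legs in \<open>hcm1\<close>: as \<open>\<delta>\<^sub>1\<close> commutes with the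
  left leg, the summand \<open>\<delta>\<^sub>1 \<otimes> Y\<close> acts on the right leg by the
  commutator with \<open>Y\<close>.\<close>

lemma coproduct_ad_X:
  assumes "h \<in> hcm1"
  shows "coproduct (cm_X * h - h * cm_X) = tensor_lift coproduct_ad (coproduct h)"
proof -
  let ?X = "cm_X \<otimes>\<^sub>t 1 + 1 \<otimes>\<^sub>t cm_X + cm_delta 1 \<otimes>\<^sub>t cm_Y"
  have "tensor_lift coproduct_ad (coproduct h) = ?X * coproduct h - coproduct h * ?X"
  proof (rule linear_eq_on_hcm1_tensor[OF hcm1_coproduct[OF assms] linear_tensor_lift[OF bilinear_coproduct_ad]])
    show "linear (\<lambda>t. ?X * t - t * ?X)" by (rule linear_commutator)
    fix a b assume "a \<in> hcm1" "b \<in> hcm1"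
    then show "tensor_lift coproduct_ad (a \<otimes>\<^sub>t b) = ?X * (a \<otimes>\<^sub>t b) - (a \<otimes>\<^sub>t b) * ?X"
      using hcm1_comm[OF \<open>a \<in> hcm1\<close> hcm1_closed(2)[of 1]]
      by (simp add: tensor_lift_tprod[OF bilinear_coproduct_ad] coproduct_ad_def linear_diff[OF linear_tprod_left]
          linear_diff[OF linear_tprod_right] distrib_left distrib_right tprod_mult)
  qed
  then show ?thesis by (simp only: algebra_homD[OF coproduct_hom] coproduct_gens)
qed

lemma bilinear_mult_comp_right:
  "linear f \<Longrightarrow> bilinear (\<lambda>a b. a * f b :: 'a::real_algebra_1)"
  and bilinear_mult_comp_left:
  "linear f \<Longrightarrow> bilinear (\<lambda>a b. f a * b :: 'a::real_algebra_1)"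
  unfolding bilinear_def
  by (intro conjI allI linear_mult_left linear_mult_right linear_comp[OF linear_mult_right]
      linear_comp[OF linear_mult_left]; assumption)+

text \<open>\<open>Z = (T * id) * Z = T * (id * Z) = 0\<close> for the convolution product.\<close>

lemma convolution_cancel_left:
  assumes T: "linear T" and Z: "linear Z"
    and inv: "\<And>h. h \<in> hcm1 \<Longrightarrow> tensor_lift (\<lambda>a b. T a * b) (coproduct h) = counit h *\<^sub>R 1"
    and zero: "\<And>h. h \<in> hcm1 \<Longrightarrow> tensor_lift (\<lambda>a b. a * Z b) (coproduct h) = 0"
    and h: "h \<in> hcm1"
  shows "Z h = 0"
proof -
  let ?L = "tensor_lift (\<lambda>a b. T a * b)" and ?R = "tensor_lift (\<lambda>a b. a * Z b)"
  \<comment> \<open>\<open>?K\<close> sends the triple tensor of \<open>a\<close>, \<open>b\<close>,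
    \<open>c\<close> to \<open>T a * b * Z c\<close>; the two bracketings read it as
    \<open>(T * id) * Z\<close> and as \<open>T * (id * Z)\<close>.\<close>
  let ?K = "tensor_lift (\<lambda>t c. ?L t * Z c)" and ?E = "tensor_lift (\<lambda>a b :: hcm. counit a *\<^sub>R b)"
  note bL = bilinear_mult_comp_left[OF T] and bR = bilinear_mult_comp_right[OF Z]
  note L = linear_tensor_lift[OF bL]
  have counit: "linear counit" using counit_spec by (simp add: counit_spec_def algebra_hom_def)
  have bK: "bilinear (\<lambda>t c. ?L t * Z c)"
    unfolding bilinear_def
    by (intro conjI allI linear_comp[OF linear_mult_right Z] linear_comp[OF linear_mult_left L])
  have bE: "bilinear (\<lambda>a b :: hcm. counit a *\<^sub>R b)"
    unfolding bilinear_def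
    by (auto intro!: linearI simp: linear_add[OF counit] linear_scale[OF counit] algebra_simps)
  note K = linear_tensor_lift[OF bK]
  note lifts = tensor_lift_tprod[OF bL] tensor_lift_tprod[OF bR] tensor_lift_tprod[OF bK] tensor_lift_tprod[OF bE]
  have "Z h = Z (?E (coproduct h))" by (simp add: counit_left)
  also have "\<dots> = ?K (assoc_left (coproduct h))"
  proof (rule linear_eq_on_hcm1_tensor[OF hcm1_coproduct[OF h]])
    show "linear (\<lambda>t. Z (?E t))" by (rule linear_comp[OF Z linear_tensor_lift[OF bE]])
    show "linear (\<lambda>t. ?K (assoc_left t))"
      unfolding assoc_left_def by (rule linear_comp[OF K linear_tensor_lift[OF bilinear_assoc_left]])
  qed (simp add: assoc_left_def tensor_lift_tprod[OF bilinear_assoc_left] lifts inv linear_scale[OF Z])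
  also have "\<dots> = ?K (assoc_right (coproduct h))"
    by (simp only: coassociative)
  also have "\<dots> = 0"
  proof (rule linear_eq_on_hcm1_tensor[OF hcm1_coproduct[OF h]])
    show "linear (\<lambda>t. ?K (assoc_right t))"
      unfolding assoc_right_def by (rule linear_comp[OF K linear_tensor_lift[OF bilinear_assoc_right]])
    fix a b :: hcm assume "b \<in> hcm1"
    have "?K (tensor_lift (\<lambda>c d :: hcm. (a \<otimes>\<^sub>t (c :: hcm)) \<otimes>\<^sub>t d) t) = T a * ?R t" for t
    proof (rule linear_eq_on_tprod[where f = "\<lambda>t. ?K (tensor_lift (\<lambda>c d :: hcm. (a \<otimes>\<^sub>t (c :: hcm)) \<otimes>\<^sub>t d) t)"])
      show "linear (\<lambda>t. ?K (tensor_lift (\<lambda>c d :: hcm. (a \<otimes>\<^sub>t (c :: hcm)) \<otimes>\<^sub>t d) t))"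
        by (rule linear_comp[OF K linear_tensor_lift[OF bilinear_assoc_right_inner]])
      show "linear (\<lambda>t. T a * ?R t)" by (rule linear_comp[OF linear_mult_right linear_tensor_lift[OF bR]])
    qed (simp add: tensor_lift_tprod[OF bilinear_assoc_right_inner] lifts mult.assoc)
    then show "?K (assoc_right (a \<otimes>\<^sub>t b)) = 0"
      by (simp add: assoc_right_def tensor_lift_tprod[OF bilinear_assoc_right] zero \<open>b \<in> hcm1\<close>)
  qed (rule linear_zero)
  finally show ?thesis .
qed

text \<open>The recursion is the case \<open>h = \<delta>\<^sub>n\<close> of
  \<open>S [X, h] = [X, S h] - \<delta>\<^sub>1 S [Y, h]\<close> on \<open>hcm1\<close>. The right
  antipode axiom for \<open>h\<close> and for \<open>[X, h]\<close> shows that the defect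
  \<open>Z\<close> of this identity satisfies \<open>id * Z = 0\<close>, and the left axiom cancels
  \<open>id\<close>.\<close>

lemma antipode_recursion:
  assumes S: "antipode_on hcm1 coproduct counit S"
  shows "S (cm_delta 1) = - cm_delta 1"
    and "n \<ge> 1 \<Longrightarrow> S (cm_delta (n + 1)) =
      cm_X * S (cm_delta n) - S (cm_delta n) * cm_X - real n *\<^sub>R (cm_delta 1 * S (cm_delta n))"
proof -
  obtain T where T: "linear T" and TS: "\<And>x. x \<in> hcm1 \<Longrightarrow> T x = S x"
    using S unfolding antipode_on_def by (elim conjE) (rule extend_linear_from_subspace[OF subspace_hcm1, of S], auto)
  note bL = bilinear_mult_comp_left[OF T] and bR = bilinear_mult_comp_right[OF T]
  let ?L = "tensor_lift (\<lambda>a b. T a * b)" and ?R = "tensor_lift (\<lambda>a b. a * T b)"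
  note L = linear_tensor_lift[OF bL] tensor_lift_tprod[OF bL]
  note R = linear_tensor_lift[OF bR] tensor_lift_tprod[OF bR]
  have inv: "?L (coproduct h) = counit h *\<^sub>R 1 \<and> ?R (coproduct h) = counit h *\<^sub>R 1" if h: "h \<in> hcm1" for h
  proof -
    obtain ps where ps: "set ps \<subseteq> hcm1 \<times> hcm1" "coproduct h = (\<Sum>(a, b)\<leftarrow>ps. a \<otimes>\<^sub>t b)"
      using hcm1_tensor_sum_list[OF hcm1_coproduct[OF h]] by blast
    have "?L (\<Sum>(a, b)\<leftarrow>ps. a \<otimes>\<^sub>t b) = (\<Sum>(a, b)\<leftarrow>ps. S a * b)"
      "?R (\<Sum>(a, b)\<leftarrow>ps. a \<otimes>\<^sub>t b) = (\<Sum>(a, b)\<leftarrow>ps. a * S b)"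
      using ps(1)
      by (induction ps) (auto simp: linear_0[OF L(1)] linear_add[OF L(1)] L(2) linear_0[OF R(1)] linear_add[OF R(1)] R(2) TS)
    with S h ps show ?thesis unfolding antipode_on_def by simp
  qed
  have counit: "algebra_hom counit" "counit (cm_delta 1) = 0"
    using counit_spec by (auto simp: counit_spec_def)
  have T1: "T 1 = 1"
    using inv[OF hcm1_closed(1)] L(2)[of 1 1]
    by (simp add: algebra_homD[OF coproduct_hom] algebra_homD[OF counit(1)] tprod_one)
  have "T (cm_delta 1) + cm_delta 1 = 0"
    using inv[OF hcm1_closed(2)[of 1]] T1
    by (simp add: coproduct_gens counit L linear_add del: One_nat_def)
  then show "S (cm_delta 1) = - cm_delta 1"
    using TS[OF hcm1_closed(2)[of 1]] by (simp add: eq_neg_iff_add_eq_0 del: One_nat_def)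

  define Z where "Z h = T (cm_X * h - h * cm_X) - (cm_X * T h - T h * cm_X)
    + cm_delta 1 * T (cm_Y * h - h * cm_Y)" for h
  have Z: "linear Z"
    unfolding Z_def
    by (intro linear_compose_add linear_compose_sub linear_comp[OF T linear_commutator] linear_comp[OF linear_mult_right T]
        linear_comp[OF linear_mult_left T] linear_comp[OF linear_mult_right linear_comp[OF T linear_commutator]])
  note bZ = bilinear_mult_comp_right[OF Z]
  have "tensor_lift (\<lambda>a b. a * Z b) (coproduct h) = 0" if h: "h \<in> hcm1" for h
  proof -
    have "tensor_lift (\<lambda>a b. a * Z b) (coproduct h) =
        ?R (tensor_lift coproduct_ad (coproduct h)) - (cm_X * ?R (coproduct h) - ?R (coproduct h) * cm_X)"
    proof (rule linear_eq_on_hcm1_tensor[OF hcm1_coproduct[OF h] linear_tensor_lift[OF bZ]])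
      show "linear (\<lambda>t. ?R (tensor_lift coproduct_ad t) - (cm_X * ?R t - ?R t * cm_X))"
        by (intro linear_compose_sub linear_comp[OF R(1) linear_tensor_lift[OF bilinear_coproduct_ad]]
            linear_comp[OF linear_mult_right R(1)] linear_comp[OF linear_mult_left R(1)])
      fix a b assume "a \<in> hcm1" "b \<in> hcm1"
      have "a * (cm_delta 1 * z) = cm_delta 1 * (a * z)" for z
        using hcm1_comm[OF \<open>a \<in> hcm1\<close> hcm1_closed(2)[of 1]] by (simp flip: mult.assoc)
      then show "tensor_lift (\<lambda>a b. a * Z b) (a \<otimes>\<^sub>t b) =
          ?R (tensor_lift coproduct_ad (a \<otimes>\<^sub>t b)) - (cm_X * ?R (a \<otimes>\<^sub>t b) - ?R (a \<otimes>\<^sub>t b) * cm_X)"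
        unfolding tensor_lift_tprod[OF bZ] tensor_lift_tprod[OF bilinear_coproduct_ad]
        by (simp add: coproduct_ad_def R(2) linear_add[OF R(1)] Z_def
            distrib_left left_diff_distrib right_diff_distrib mult.assoc del: One_nat_def)
    qed
    also have "\<dots> = ?R (coproduct (cm_X * h - h * cm_X)) - (cm_X * ?R (coproduct h) - ?R (coproduct h) * cm_X)"
      by (simp only: coproduct_ad_X[OF h])
    \<comment> \<open>The counit has commutative values, hence vanishes on commutators, and
      multiples of 1 commute with \<open>cm_X\<close>.\<close>
    also have "\<dots> = 0"
      using inv[OF h] inv[OF hcm1_adX[OF h]] by (simp add: algebra_homD[OF counit(1)])
    finally show ?thesis .
  qed
  from convolution_cancel_left[OF T Z _ this] inv have "Z h = 0" if "h \<in> hcm1" for h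
    using that by blast
  from this[OF hcm1_closed(2)] show "S (cm_delta (n + 1)) =
      cm_X * S (cm_delta n) - S (cm_delta n) * cm_X - real n *\<^sub>R (cm_delta 1 * S (cm_delta n))" if "n \<ge> 1"
    using that by (simp add: Z_def hcm_relations(2,3) linear_scale[OF T] TS hcm1_closed(2) algebra_simps del: One_nat_def
        flip: Suc_eq_plus1 Suc_eq_plus1_left)
qed

section \<open>Comparison of the two recursions\<close>

theorem theorem3:
  fixes n :: nat and S :: "hcm \<Rightarrow> hcm"
  assumes "n \<ge> 1"
    and "antipode_on hcm1 coproduct counit S"
  shows "S (cm_delta n) =
    (\<Sum>ns | ns \<noteq> [] \<and> (\<forall>k\<in>set ns. k \<ge> 1) \<and> sum_list ns = n.
       (fact n / (\<Prod>k\<leftarrow>ns. fact k) * cm_beta ns) *\<^sub>R (\<Prod>k\<leftarrow>ns. cm_delta k))"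
proof -
  \<comment> \<open>The value at 0 is set by hand, since truncated subtraction makes
    \<open>cm_delta 0\<close> equal to \<open>cm_delta 1\<close>.\<close>
  define a where "a k = (if k = 0 then 0 else (1 / fact k) *\<^sub>R cm_delta k)" for k
  have ad: "cm_X * a k - a k * cm_X = real (k + 1) *\<^sub>R a (k + 1)" if "k \<ge> 1" for k
    using hcm_relations(3)[OF that] that
    by (simp add: a_def flip: scaleR_diff_right)
  have comm: "a 1 * a k = a k * a 1" for k
    by (simp add: a_def hcm_relations(4)[of _ k])
  note rec = antipode_coef_Suc[of a cm_X, OF _ ad comm]
  have a1: "a 1 = cm_delta 1" and a0: "a 0 = 0" by (simp_all add: a_def)
  \<comment> \<open>Both sides start at \<open>- cm_delta 1\<close>, and multiplying the recursion
    of \<open>antipode_coef\<close> by \<open>fact n\<close> gives that of \<open>S\<close>.\<close>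
  have "S (cm_delta n) = fact n *\<^sub>R antipode_coef a n"
    using assms(1)
  proof (induction n rule: nat_induct_at_least)
    case base
    have "antipode_coef a 1 = - cm_delta 1"
      using rec[of 0] a0 a1 by (simp add: antipode_coef_def)
    then show ?case by (simp add: antipode_recursion(1)[OF assms(2), simplified])
  next
    case (Suc n)
    have "S (cm_delta (Suc n)) = fact n *\<^sub>R (cm_X * antipode_coef a n - antipode_coef a n * cm_X
        - real n *\<^sub>R (a 1 * antipode_coef a n))"
      using antipode_recursion(2)[OF assms(2) Suc.hyps]
      by (simp add: Suc.IH a1 scaleR_diff_right mult.commute del: One_nat_def flip: Suc_eq_plus1)
    also have "\<dots> = fact (Suc n) *\<^sub>R antipode_coef a (Suc n)"
      using rec[of n] a0 Suc.hyps by (simp add: mult.commute flip: scaleR_scaleR)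
    finally show ?case .
  qed
  also have "\<dots> = (\<Sum>ns\<in>compositions n. fact n *\<^sub>R (cm_beta ns *\<^sub>R prod_list (map a ns)))"
    using assms(1) by (simp add: antipode_coef_def scaleR_sum_right)
  also have "\<dots> = (\<Sum>ns | ns \<noteq> [] \<and> (\<forall>k\<in>set ns. k \<ge> 1) \<and> sum_list ns = n.
       (fact n / (\<Prod>k\<leftarrow>ns. fact k) * cm_beta ns) *\<^sub>R (\<Prod>k\<leftarrow>ns. cm_delta k))"
  \<comment> \<open>The factorials in \<open>a\<close> form the denominator, and
    \<open>n \<ge> 1\<close> excludes the empty composition.\<close>
  proof (rule sum.cong)
    fix ns :: "nat list"
    have "prod_list (map a ns) = (1 / (\<Prod>k\<leftarrow>ns. fact k)) *\<^sub>R (\<Prod>k\<leftarrow>ns. cm_delta k)" if "\<forall>k\<in>set ns. k \<ge> 1"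
      using that by (induction ns) (auto simp: a_def)
    moreover assume "ns \<in> {ns. ns \<noteq> [] \<and> (\<forall>k\<in>set ns. k \<ge> 1) \<and> sum_list ns = n}"
    ultimately show "fact n *\<^sub>R (cm_beta ns *\<^sub>R prod_list (map a ns)) =
        (fact n / (\<Prod>k\<leftarrow>ns. fact k) * cm_beta ns) *\<^sub>R (\<Prod>k\<leftarrow>ns. cm_delta k)"
      by simp
  qed (use assms(1) in \<open>auto simp: compositions_def\<close>)
  finally show ?thesis .
qed

end
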